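(* Let $\mathcal X\subseteq\mathbb R^d$ be nonempty, closed, convex, with $\|x-y\|_2\le R$ for all $x,y\in\mathcal X$. Let $f_1,\dots,f_n:\mathbb R^d\to\mathbb R$ be convex, $G$-Lipschitz with respect to $\|\cdot\|_2$, and satisfy $f_i(x)\in[0,M]$ for all $x\in\mathcal X$ and $i\in\{1,\dots,n\}$. Let $\alpha\in[1/n,1]$ and let $\epsilon\in(0,4M)$ be the target error. Then there exists an algorithm which computes an expected $\epsilon$-optimal point of the dual CVaR problem $$\text{maximize}_{y\in\Delta^n,\ \|y\|_\infty\le\frac1{\alpha n}}\ \phi(y),\qquad\phi(y):=\min_{x\in\mathcal X}\sum_{i=1}^ny_if_i(x),$$ with complexity $\widetilde O\!\left(n+G^2R^2\alpha^{-1}\epsilon^{-2}\right)$.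
   Context: $\Delta^n:=\{y\in\mathbb R^n_{\ge0}:\|y\|_1=1\}$. Complexity is measured by the number of first-order queries, where one first-order query is the evaluation of $(f_i(x),\nabla f_i(x))$ for one $x\in\mathcal X$ and one $i\in\{1,\dots,n\}$; the $f_i$ need not be differentiable, and $\nabla f_i(x)$ denotes some subgradient. $\widetilde O(\cdot)$ hides polylogarithmic factors (in the problem parameters $n,d,R,G,M,\epsilon^{-1}$). A random feasible $y$ is an expected $\epsilon$-optimal point if $\phi(y')\le\mathbb E\,\phi(y)+\epsilon$ for every feasible $y'$, the expectation being over the algorithm's internal randomness. *)

theory Defs
  imports "HOL-Probability.Probability"
begin

text \<open>
  The complexity bound must be uniform in the dimension \<open>d\<close>, so \<open>\<real>\<^sup>d\<close> cannot be
  a type indexed by its dimension.  It is the carrier of the library topology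
  \<^term>\<open>Euclidean_space d\<close>: the functions \<open>nat \<Rightarrow> real\<close> that vanish at all indices \<open>\<ge> d\<close>.
  The functions \<open>nat \<Rightarrow> real\<close> are not a \<open>real_vector\<close> instance, so the convexity notions
  below are the textbook ones written out componentwise.  The components \<open>f\<^sub>1, \<dots>, f\<^sub>n\<close>
  and \<open>y\<^sub>1, \<dots>, y\<^sub>n\<close> are indexed by \<open>0, \<dots>, n - 1\<close>.
\<close>

type_synonym rvec = "nat \<Rightarrow> real"

abbreviation Rspace :: "nat \<Rightarrow> rvec set"
  where "Rspace d \<equiv> topspace (Euclidean_space d)"

definition l2_dist :: "nat \<Rightarrow> rvec \<Rightarrow> rvec \<Rightarrow> real"
  where "l2_dist d x y = L2_set (\<lambda>j. x j - y j) {..<d}"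

definition segment_point :: "real \<Rightarrow> rvec \<Rightarrow> rvec \<Rightarrow> rvec"
  where "segment_point t x y = (\<lambda>j. (1 - t) * x j + t * y j)"

definition convex_vset :: "rvec set \<Rightarrow> bool"
  where "convex_vset X \<longleftrightarrow> (\<forall>x\<in>X. \<forall>y\<in>X. \<forall>t\<in>{0..1}. segment_point t x y \<in> X)"

definition convex_fun_on :: "rvec set \<Rightarrow> (rvec \<Rightarrow> real) \<Rightarrow> bool"
  where "convex_fun_on S h \<longleftrightarrow>
    (\<forall>x\<in>S. \<forall>y\<in>S. \<forall>t\<in>{0..1}. h (segment_point t x y) \<le> (1 - t) * h x + t * h y)"

definition l2_lipschitz :: "nat \<Rightarrow> real \<Rightarrow> (rvec \<Rightarrow> real) \<Rightarrow> bool"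
  where "l2_lipschitz d G h \<longleftrightarrow>
    0 \<le> G \<and> (\<forall>x\<in>Rspace d. \<forall>y\<in>Rspace d. \<bar>h x - h y\<bar> \<le> G * l2_dist d x y)"

definition is_subgradient :: "nat \<Rightarrow> (rvec \<Rightarrow> real) \<Rightarrow> rvec \<Rightarrow> rvec \<Rightarrow> bool"
  where "is_subgradient d h x v \<longleftrightarrow>
    v \<in> Rspace d \<and> (\<forall>z\<in>Rspace d. h z \<ge> h x + (\<Sum>j<d. v j * (z j - x j)))"

definition prob_simplex :: "nat \<Rightarrow> rvec set"
  where "prob_simplex n = {y \<in> Rspace n. (\<forall>i<n. 0 \<le> y i) \<and> (\<Sum>i<n. \<bar>y i\<bar>) = 1}"

definition cvar_dual_feasible :: "nat \<Rightarrow> real \<Rightarrow> rvec set"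
  where "cvar_dual_feasible n \<alpha> = {y \<in> prob_simplex n. \<forall>i<n. \<bar>y i\<bar> \<le> 1 / (\<alpha> * real n)}"

text \<open>
  The infimum below is attained whenever \<open>X\<close> is nonempty, closed and bounded and the
  \<open>f\<^sub>i\<close> are Lipschitz, so it is the minimum in every case where it is used.
\<close>

definition dual_objective :: "nat \<Rightarrow> rvec set \<Rightarrow> (nat \<Rightarrow> rvec \<Rightarrow> real) \<Rightarrow> rvec \<Rightarrow> real"
  where "dual_objective n X f y = (INF x\<in>X. \<Sum>i<n. y i * f i x)"

definition expected_eps_optimal ::
    "rvec set \<Rightarrow> (rvec \<Rightarrow> real) \<Rightarrow> real \<Rightarrow> rvec pmf \<Rightarrow> bool"
  where "expected_eps_optimal Y \<phi> \<epsilon> P \<longleftrightarrow>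
    set_pmf P \<subseteq> Y \<and> (\<forall>y'\<in>Y. \<phi> y' \<le> measure_pmf.expectation P \<phi> + \<epsilon>)"

text \<open>
  A randomized first-order query algorithm is a decision tree.  It stops with an output,
  draws its continuation at random, or queries component \<open>i\<close> at the point \<open>x\<close> and continues
  depending on the answer (function value, subgradient).  It has no other access to the
  \<open>f\<^sub>i\<close>; computation between queries is free.  Every branch of a tree is finite.
\<close>

datatype query_alg =
    Output rvec
  | Sample "query_alg pmf"
  | Query nat rvec "real \<times> rvec \<Rightarrow> query_alg"

text \<open>The joint distribution of the list of queries made and the output.\<close>

primrec run_alg ::
    "(nat \<Rightarrow> rvec \<Rightarrow> real \<times> rvec) \<Rightarrow> query_alg \<Rightarrow> ((nat \<times> rvec) list \<times> rvec) pmf"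
  where
    "run_alg orc (Output y) = return_pmf ([], y)"
  | "run_alg orc (Sample p) = join_pmf (map_pmf (run_alg orc) p)"
  | "run_alg orc (Query i x k) =
       map_pmf (\<lambda>(qs, y). ((i, x) # qs, y)) (run_alg orc (k (orc i x)))"

definition first_order_oracle ::
    "(nat \<Rightarrow> rvec \<Rightarrow> real) \<Rightarrow> (nat \<Rightarrow> rvec \<Rightarrow> rvec) \<Rightarrow> nat \<Rightarrow> rvec \<Rightarrow> real \<times> rvec"
  where "first_order_oracle f g i x = (f i x, g i x)"

text \<open>
  \<open>B\<close> times a polylogarithmic factor.  Every product of powers of \<open>ln (2 + t)\<close> for \<open>t\<close> among
  \<open>n, d, R, G, M, 1/\<epsilon>\<close> is at most such a last factor, for a suitable exponent \<open>k\<close>.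
  The shift by \<open>2\<close> keeps the logarithm at least \<open>1\<close> when \<open>n \<ge> 1\<close>.
\<close>

definition soft_O_bound ::
    "real \<Rightarrow> nat \<Rightarrow> nat \<Rightarrow> nat \<Rightarrow> real \<Rightarrow> real \<Rightarrow> real \<Rightarrow> real \<Rightarrow> real \<Rightarrow> real"
  where "soft_O_bound C k n d R G M \<epsilon> B =
    C * B * ln (2 + real n + real d + R + G + M + 1 / \<epsilon>) ^ k"

end

theory Submission
  imports Defs
begin

text \<open>
  Proximal point method in the dual variable with entropic regularization.  A phase with
  reference point \<open>q\<close> and strength \<open>\<Lambda>\<close> approximately minimizes
  \<open>F(x) = max\<^sub>y (\<Sum>\<^sub>i y\<^sub>i f\<^sub>i(x) - \<Lambda> KL(y, q))\<close> over \<open>X\<close> and passes on the best response \<open>q'\<close> at the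
  point found.  If the dual solution of the phase is \<open>p'\<close>, strong concavity gives
  \<open>\<Lambda> KL(p', q') \<le> F(x) - min F\<close>, so doubling \<open>\<Lambda>\<close> from phase to phase loses only a multiple of
  the primal error each time, and after logarithmically many phases \<open>q'\<close> itself is nearly as
  good as \<open>p'\<close>.

  By Lagrangian duality \<open>F(x) = min\<^sub>\<nu> (\<nu> + \<Sum>\<^sub>i h\<^sub>i(f\<^sub>i(x) - \<nu>))\<close>, and this is minimized by stochastic
  subgradient steps in \<open>(x, \<nu>)\<close> that query one uniformly random component.  With
  \<open>w = n h\<^sub>i' \<le> 1 / \<alpha>\<close> the second moment is at most \<open>G\<^sup>2 / \<alpha>\<close> times the total mass
  \<open>\<Sum>\<^sub>i h\<^sub>i'\<close>.  The mass at \<open>\<nu>\<close> is at most \<open>e\<close> times the mass at \<open>\<nu> + \<Lambda>\<close>, which convexity bounds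
  by one plus the suboptimality gap over \<open>\<Lambda>\<close>; hence the gap controls the variance.
  A full pass of \<open>n\<close> queries at the start locates \<open>\<nu>\<close> up to \<open>G R\<close>.
\<close>

section \<open>Capped entropic best responses\<close>

text \<open>The Bregman divergence of \<open>y * ln y\<close>. Between vectors of equal sum the
  linear part cancels and the Kullback-Leibler divergence remains; keeping it makes every single
  term nonnegative, even against weights that do not sum to one.\<close>

definition kl_term :: "real \<Rightarrow> real \<Rightarrow> real"
  where "kl_term y q = y * ln (y / q) - y + q"

definition capped_exp :: "real \<Rightarrow> real \<Rightarrow> real \<Rightarrow> real \<Rightarrow> real"
  where "capped_exp c \<Lambda> q s = min c (q * exp (s / \<Lambda>))"

text \<open>
  The conjugate of \<open>y \<mapsto> \<Lambda> kl_term y q\<close> on \<open>[0, c]\<close>, with maximizer \<open>capped_exp\<close>; these are the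
  functions \<open>h\<^sub>i\<close> and \<open>h\<^sub>i'\<close> above.
\<close>

definition capped_conj :: "real \<Rightarrow> real \<Rightarrow> real \<Rightarrow> real \<Rightarrow> real"
  where "capped_conj c \<Lambda> q s =
    capped_exp c \<Lambda> q s * s - \<Lambda> * kl_term (capped_exp c \<Lambda> q s) q"

text \<open>Multiply \<open>ln t \<le> 2 * (sqrt t - 1)\<close> at \<open>t = q / y\<close> by
  \<open>y\<close>. The square-root form prepares Cauchy-Schwarz.\<close>

lemma hellinger_le_kl_term:
  assumes "0 \<le> y" "0 < q"
  shows "(sqrt y - sqrt q)\<^sup>2 \<le> kl_term y q"
proof (cases "y = 0")
  case True
  with assms show ?thesis by (simp add: kl_term_def)
next
  case False
  with assms have y: "0 < y" by simp
  have "ln (q / y) = 2 * ln (sqrt (q / y))"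
    using y assms by (simp add: ln_sqrt)
  also have "\<dots> \<le> 2 * (sqrt (q / y) - 1)"
    using ln_le_minus_one[of "sqrt (q / y)"] y assms by simp
  finally have "y * ln (q / y) \<le> y * (2 * (sqrt (q / y) - 1))"
    using y by (intro mult_left_mono) auto
  moreover have "y * sqrt (q / y) = sqrt y * sqrt q"
  proof -
    have "y * sqrt (q / y) = (sqrt y * sqrt y) * (sqrt q / sqrt y)"
      using y by (simp add: real_sqrt_divide)
    also have "\<dots> = sqrt y * sqrt q" using y by (simp del: real_sqrt_mult_self)
    finally show ?thesis .
  qed
  moreover have "ln (y / q) = - ln (q / y)"
    using y assms by (simp add: ln_div)
  ultimately show ?thesis
    using y assms by (simp add: kl_term_def power2_diff algebra_simps)
qed

lemma kl_term_nonneg: "0 \<le> y \<Longrightarrow> 0 < q \<Longrightarrow> 0 \<le> kl_term y q"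
  using hellinger_le_kl_term[of y q] zero_le_power2 order_trans by blast

lemma capped_exp_pos: "0 < c \<Longrightarrow> 0 < q \<Longrightarrow> 0 < capped_exp c \<Lambda> q s"
  by (simp add: capped_exp_def)

lemma capped_exp_le: "capped_exp c \<Lambda> q s \<le> c"
  by (simp add: capped_exp_def)

lemma capped_exp_mono:
  "0 < \<Lambda> \<Longrightarrow> 0 < q \<Longrightarrow> s \<le> t \<Longrightarrow> capped_exp c \<Lambda> q s \<le> capped_exp c \<Lambda> q t"
  unfolding capped_exp_def by (intro min.mono mult_left_mono) (auto simp: divide_right_mono)

lemma capped_exp_shift:
  assumes "0 < \<Lambda>" "0 < c"
  shows "capped_exp c \<Lambda> q s \<le> exp 1 * capped_exp c \<Lambda> q (s - \<Lambda>)"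
proof -
  have "exp (s / \<Lambda>) = exp 1 * exp ((s - \<Lambda>) / \<Lambda>)"
    using assms by (simp add: exp_add[symmetric] diff_divide_distrib)
  moreover have "c \<le> exp 1 * c"
    using assms by (simp add: one_le_exp_iff)
  moreover have "exp 1 * min c b = min (exp 1 * c) (exp 1 * b)" for b :: real
    by (simp add: min_mult_distrib_left)
  ultimately show ?thesis
    unfolding capped_exp_def by (simp add: mult_ac min.coboundedI1 min.coboundedI2)
qed

text \<open>The concave objective has derivative \<open>s - \<Lambda> * ln (y / q)\<close>. At the
  maximizer \<open>a\<close> this is zero, or nonnegative if the cap binds, so its product with
  \<open>a - y\<close> is nonnegative; the entropy turns the remainder into exactly a divergence to
  \<open>a\<close>.\<close>

lemma capped_conj_three_point:
  assumes "0 < \<Lambda>" "0 < q" "0 < c" "0 \<le> y" "y \<le> c"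
  shows "y * s - \<Lambda> * kl_term y q + \<Lambda> * kl_term y (capped_exp c \<Lambda> q s) \<le> capped_conj c \<Lambda> q s"
proof -
  define a where "a = capped_exp c \<Lambda> q s"
  have a: "0 < a" using assms by (simp add: a_def capped_exp_pos)
  have ln_split: "y * ln (y / q) - y * ln (y / a) = y * ln (a / q)"
    using assms a by (cases "y = 0") (auto simp: ln_div algebra_simps)
  have "0 \<le> (a - y) * (s - \<Lambda> * ln (a / q))"
  proof (cases "q * exp (s / \<Lambda>) \<le> c")
    case True
    then have "a = q * exp (s / \<Lambda>)" by (simp add: a_def capped_exp_def min_def)
    then show ?thesis using assms by simp
  next
    case False
    then have ac: "a = c" by (simp add: a_def capped_exp_def)
    have "ln (c / q) \<le> ln (exp (s / \<Lambda>))"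
      using False assms by (subst ln_le_cancel_iff) (auto simp: field_simps)
    then have "\<Lambda> * ln (a / q) \<le> s"
      using assms by (simp add: ac field_simps)
    then show ?thesis using ac assms by simp
  qed
  then have "y * s - \<Lambda> * (y * ln (a / q)) \<le> a * s - \<Lambda> * (a * ln (a / q))"
    by (simp add: algebra_simps)
  then show ?thesis
    unfolding capped_conj_def a_def[symmetric] kl_term_def ln_split[symmetric]
    by (simp add: algebra_simps)
qed

text \<open>The maximizer at \<open>s\<close> is a feasible competitor at \<open>t\<close>; drop the
  divergence from the three-point inequality.\<close>

lemma capped_conj_subgradient:
  assumes "0 < \<Lambda>" "0 < q" "0 < c"
  shows "capped_conj c \<Lambda> q s + capped_exp c \<Lambda> q s * (t - s) \<le> capped_conj c \<Lambda> q t"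
proof -
  have pos: "0 < capped_exp c \<Lambda> q u" for u
    using assms by (simp add: capped_exp_pos)
  have "0 \<le> \<Lambda> * kl_term (capped_exp c \<Lambda> q s) (capped_exp c \<Lambda> q t)"
    using assms pos by (intro mult_nonneg_nonneg kl_term_nonneg) (auto intro: less_imp_le)
  moreover have "capped_exp c \<Lambda> q s * t - \<Lambda> * kl_term (capped_exp c \<Lambda> q s) q
      + \<Lambda> * kl_term (capped_exp c \<Lambda> q s) (capped_exp c \<Lambda> q t) \<le> capped_conj c \<Lambda> q t"
    using assms pos by (intro capped_conj_three_point) (auto intro: less_imp_le capped_exp_le)
  ultimately show ?thesis
    by (simp add: capped_conj_def algebra_simps)
qed

section \<open>Divergence and regularized maximum on the capped simplex\<close>

definition kl_div :: "nat \<Rightarrow> rvec \<Rightarrow> rvec \<Rightarrow> real"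
  where "kl_div n y q = (\<Sum>i<n. kl_term (y i) (q i))"

definition capped_simplex :: "nat \<Rightarrow> real \<Rightarrow> rvec set"
  where "capped_simplex n c =
    {y. (\<forall>i\<ge>n. y i = 0) \<and> (\<forall>i<n. 0 \<le> y i \<and> y i \<le> c) \<and> (\<Sum>i<n. y i) = 1}"

definition pos_capped_simplex :: "nat \<Rightarrow> real \<Rightarrow> rvec set"
  where "pos_capped_simplex n c = {y \<in> capped_simplex n c. \<forall>i<n. 0 < y i}"

text \<open>A root is chosen because it need not be unique: for \<open>c = 1 / n\<close> all
  components sit at the cap for every sufficiently small \<open>\<nu>\<close>.\<close>

definition multiplier :: "nat \<Rightarrow> real \<Rightarrow> real \<Rightarrow> rvec \<Rightarrow> rvec \<Rightarrow> real"
  where "multiplier n c \<Lambda> q v = (SOME \<nu>. (\<Sum>i<n. capped_exp c \<Lambda> (q i) (v i - \<nu>)) = 1)"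

definition response :: "nat \<Rightarrow> real \<Rightarrow> real \<Rightarrow> rvec \<Rightarrow> rvec \<Rightarrow> rvec"
  where "response n c \<Lambda> q v =
    (\<lambda>i. if i < n then capped_exp c \<Lambda> (q i) (v i - multiplier n c \<Lambda> q v) else 0)"

text \<open>Taken as the value at the response instead of a supremum; \<open>reg_max_ge\<close>
  shows that no member of the capped simplex does better.\<close>

definition reg_max :: "nat \<Rightarrow> real \<Rightarrow> real \<Rightarrow> rvec \<Rightarrow> rvec \<Rightarrow> real"
  where "reg_max n c \<Lambda> q v =
    (\<Sum>i<n. response n c \<Lambda> q v i * v i) - \<Lambda> * kl_div n (response n c \<Lambda> q v) q"

lemma cvar_dual_feasible_eq: "cvar_dual_feasible n \<alpha> = capped_simplex n (1 / (\<alpha> * real n))"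
proof -
  have "(\<Sum>i<n. \<bar>y i\<bar>) = (\<Sum>i<n. y i)" if "\<forall>i<n. 0 \<le> y i" for y :: rvec
    using that by (intro sum.cong) auto
  then show ?thesis
    by (auto simp: cvar_dual_feasible_def prob_simplex_def capped_simplex_def
        topspace_Euclidean_space)
qed

lemma kl_div_nonneg:
  assumes "y \<in> capped_simplex n c" "q \<in> pos_capped_simplex n c"
  shows "0 \<le> kl_div n y q"
  using assms unfolding kl_div_def
  by (intro sum_nonneg kl_term_nonneg) (auto simp: capped_simplex_def pos_capped_simplex_def)

text \<open>A Pinsker inequality through the Hellinger distance: factor each difference into
  difference and sum of square roots and apply Cauchy-Schwarz. The squared sums total at most
  \<open>2 + 2\<close>.\<close>

lemma l1_sq_le_kl_div:
  assumes "y \<in> capped_simplex n c" "q \<in> pos_capped_simplex n c"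
  shows "(\<Sum>i<n. \<bar>y i - q i\<bar>)\<^sup>2 \<le> 4 * kl_div n y q"
proof -
  have y: "\<And>i. i < n \<Longrightarrow> 0 \<le> y i" "(\<Sum>i<n. y i) = 1"
    and q: "\<And>i. i < n \<Longrightarrow> 0 < q i" "(\<Sum>i<n. q i) = 1"
    using assms by (auto simp: capped_simplex_def pos_capped_simplex_def)
  have "(\<Sum>i<n. \<bar>y i - q i\<bar>) = (\<Sum>i<n. \<bar>sqrt (y i) - sqrt (q i)\<bar> * (sqrt (y i) + sqrt (q i)))"
  proof (intro sum.cong refl)
    fix i assume "i \<in> {..<n}"
    then have "0 \<le> y i" "0 \<le> q i" using y q less_imp_le by auto
    then have "y i - q i = (sqrt (y i) - sqrt (q i)) * (sqrt (y i) + sqrt (q i))"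
      by (simp add: algebra_simps)
    then show "\<bar>y i - q i\<bar> = \<bar>sqrt (y i) - sqrt (q i)\<bar> * (sqrt (y i) + sqrt (q i))"
      using \<open>0 \<le> y i\<close> \<open>0 \<le> q i\<close> by (simp add: abs_mult)
  qed
  then have "(\<Sum>i<n. \<bar>y i - q i\<bar>)\<^sup>2 \<le>
      (\<Sum>i<n. \<bar>sqrt (y i) - sqrt (q i)\<bar>\<^sup>2) * (\<Sum>i<n. (sqrt (y i) + sqrt (q i))\<^sup>2)"
    using Cauchy_Schwarz_ineq_sum by metis
  also have "\<dots> \<le> kl_div n y q * 4"
  proof (rule mult_mono)
    show "(\<Sum>i<n. \<bar>sqrt (y i) - sqrt (q i)\<bar>\<^sup>2) \<le> kl_div n y q"
      unfolding kl_div_def using y q hellinger_le_kl_term by (intro sum_mono) auto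
    have "(\<Sum>i<n. (sqrt (y i) + sqrt (q i))\<^sup>2) \<le> (\<Sum>i<n. 2 * y i + 2 * q i)"
    proof (intro sum_mono)
      fix i assume "i \<in> {..<n}"
      then have "0 \<le> y i" "0 \<le> q i" using y q less_imp_le by auto
      then have "(sqrt (y i))\<^sup>2 = y i" "(sqrt (q i))\<^sup>2 = q i" by auto
      then show "(sqrt (y i) + sqrt (q i))\<^sup>2 \<le> 2 * y i + 2 * q i"
        using sum_squares_bound[of "sqrt (y i)" "sqrt (q i)"] by (simp add: power2_sum)
    qed
    also have "\<dots> = 4" using y q by (simp add: sum.distrib sum_distrib_left[symmetric])
    finally show "(\<Sum>i<n. (sqrt (y i) + sqrt (q i))\<^sup>2) \<le> 4" .
  qed (use kl_div_nonneg[OF assms] in \<open>auto intro: sum_nonneg\<close>)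
  finally show ?thesis by simp
qed

lemma kl_div_uniform_le:
  assumes "y \<in> capped_simplex n c" "1 \<le> n"
  shows "kl_div n y (\<lambda>i. if i < n then 1 / real n else 0) \<le> ln (real n)"
proof -
  have y: "\<And>i. i < n \<Longrightarrow> 0 \<le> y i" "(\<Sum>i<n. y i) = 1"
    using assms by (auto simp: capped_simplex_def)
  have "kl_div n y (\<lambda>i. if i < n then 1 / real n else 0)
      \<le> (\<Sum>i<n. y i * ln (real n) - y i + 1 / real n)"
    unfolding kl_div_def
  proof (intro sum_mono)
    fix i assume i: "i \<in> {..<n}"
    have "y i \<le> (\<Sum>i<n. y i)"
      using i y by (intro member_le_sum) auto
    then have "y i \<le> 1" using y by simp
    then have "y i * ln (y i * real n) \<le> y i * ln (real n)"
      using y(1)[of i] i assms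
      by (cases "y i = 0") (auto intro!: mult_left_mono simp: ln_mult)
    then show "kl_term (y i) (if i < n then 1 / real n else 0)
        \<le> y i * ln (real n) - y i + 1 / real n"
      using i by (simp add: kl_term_def)
  qed
  also have "\<dots> = ln (real n)"
    using y assms by (simp add: sum.distrib sum_subtractf sum_distrib_right[symmetric])
  finally show ?thesis .
qed

section \<open>Lagrangian duality for the constraint that the weights sum to one\<close>

locale capped_reg =
  fixes n :: nat and c \<Lambda> :: real and q :: rvec
  assumes c_pos: "0 < c" and \<Lambda>_pos: "0 < \<Lambda>" and q_in: "q \<in> pos_capped_simplex n c"
begin

lemma q_pos: "i < n \<Longrightarrow> 0 < q i" and q_le: "i < n \<Longrightarrow> q i \<le> c" and q_sum: "(\<Sum>i<n. q i) = 1"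
  using q_in by (auto simp: pos_capped_simplex_def capped_simplex_def)

abbreviation mass :: "rvec \<Rightarrow> real \<Rightarrow> real"
  where "mass v \<nu> \<equiv> \<Sum>i<n. capped_exp c \<Lambda> (q i) (v i - \<nu>)"

abbreviation lagrangian :: "rvec \<Rightarrow> real \<Rightarrow> real"
  where "lagrangian v \<nu> \<equiv> \<nu> + (\<Sum>i<n. capped_conj c \<Lambda> (q i) (v i - \<nu>))"

lemma mass_root_between:
  assumes "a \<le> b" "1 \<le> mass v a" "mass v b \<le> 1"
  obtains \<nu> where "a \<le> \<nu>" "\<nu> \<le> b" "mass v \<nu> = 1"
proof -
  have "continuous_on {a..b} (mass v)"
    unfolding capped_exp_def using \<Lambda>_pos by (intro continuous_intros) auto
  from IVT2'[OF assms(3,2,1) this] that show thesis by blast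
qed

text \<open>With \<open>B\<close> bounding all entries of \<open>v\<close>, each weight is at least
  \<open>q i\<close> at \<open>-B\<close>, as \<open>q\<close> respects the cap, and at most
  \<open>q i\<close> at \<open>B\<close>. Since \<open>q\<close> sums to one, the mass crosses one
  in between.\<close>

lemma mass_multiplier: "mass v (multiplier n c \<Lambda> q v) = 1"
proof -
  define B where "B = (\<Sum>i<n. \<bar>v i\<bar>)"
  have B: "\<bar>v i\<bar> \<le> B" if "i < n" for i
    unfolding B_def using that by (intro member_le_sum[of _ _ "\<lambda>i. \<bar>v i\<bar>"]) auto
  have B0: "0 \<le> B" by (simp add: B_def sum_nonneg)
  have "(\<Sum>i<n. q i) \<le> mass v (- B)"
  proof (intro sum_mono)
    fix i assume i: "i \<in> {..<n}"
    then have "1 \<le> exp ((v i + B) / \<Lambda>)" using B[of i] \<Lambda>_pos by (simp add: one_le_exp_iff)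
    then have "q i \<le> q i * exp ((v i + B) / \<Lambda>)" using q_pos[of i] i by simp
    then show "q i \<le> capped_exp c \<Lambda> (q i) (v i - - B)"
      using q_le[of i] i by (simp add: capped_exp_def)
  qed
  moreover have "mass v B \<le> (\<Sum>i<n. q i)"
  proof (intro sum_mono)
    fix i assume i: "i \<in> {..<n}"
    then have "exp ((v i - B) / \<Lambda>) \<le> 1" using B[of i] \<Lambda>_pos by (simp add: divide_le_0_iff)
    then have "q i * exp ((v i - B) / \<Lambda>) \<le> q i" using q_pos[of i] i by (simp add: mult_left_le)
    then show "capped_exp c \<Lambda> (q i) (v i - B) \<le> q i"
      by (simp add: capped_exp_def min.coboundedI2)
  qed
  ultimately obtain \<nu> where "mass v \<nu> = 1"
    using mass_root_between[of "- B" B v] B0 q_sum by auto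
  then show ?thesis unfolding multiplier_def by (rule someI)
qed

lemma response_in: "response n c \<Lambda> q v \<in> pos_capped_simplex n c"
  using mass_multiplier[of v] c_pos q_pos
  by (auto simp: response_def pos_capped_simplex_def capped_simplex_def capped_exp_le
      intro!: capped_exp_pos less_imp_le[OF capped_exp_pos])

text \<open>Weak duality for every \<open>\<nu>\<close>, with the slack kept as a divergence: the
  shift by \<open>\<nu>\<close> contributes exactly \<open>\<nu>\<close> because \<open>y\<close>
  sums to one.\<close>

lemma three_point_lagrangian:
  assumes y: "y \<in> capped_simplex n c"
  shows "(\<Sum>i<n. y i * v i) - \<Lambda> * kl_div n y q
      + \<Lambda> * (\<Sum>i<n. kl_term (y i) (capped_exp c \<Lambda> (q i) (v i - \<nu>))) \<le> lagrangian v \<nu>"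
proof -
  have "(\<Sum>i<n. y i * (v i - \<nu>) - \<Lambda> * kl_term (y i) (q i)
        + \<Lambda> * kl_term (y i) (capped_exp c \<Lambda> (q i) (v i - \<nu>)))
      \<le> (\<Sum>i<n. capped_conj c \<Lambda> (q i) (v i - \<nu>))"
    using y q_pos c_pos \<Lambda>_pos
    by (intro sum_mono capped_conj_three_point) (auto simp: capped_simplex_def)
  moreover have "(\<Sum>i<n. y i * (v i - \<nu>)) = (\<Sum>i<n. y i * v i) - \<nu>"
    using y by (simp add: capped_simplex_def right_diff_distrib sum_subtractf
        sum_distrib_right[symmetric])
  ultimately show ?thesis
    by (simp add: kl_div_def sum.distrib sum_subtractf sum_distrib_left[symmetric])
qed

lemma lagrangian_at_root:
  assumes "mass v \<nu> = 1"
  shows "lagrangian v \<nu> = (\<Sum>i<n. capped_exp c \<Lambda> (q i) (v i - \<nu>) * v i)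
    - \<Lambda> * (\<Sum>i<n. kl_term (capped_exp c \<Lambda> (q i) (v i - \<nu>)) (q i))"
  using assms
  by (simp add: capped_conj_def right_diff_distrib sum_subtractf sum_distrib_left[symmetric]
      sum_distrib_right[symmetric])

lemma reg_max_eq_lagrangian: "reg_max n c \<Lambda> q v = lagrangian v (multiplier n c \<Lambda> q v)"
  by (simp add: lagrangian_at_root[OF mass_multiplier] reg_max_def response_def kl_div_def)

lemma reg_max_three_point:
  assumes "y \<in> capped_simplex n c"
  shows "(\<Sum>i<n. y i * v i) - \<Lambda> * kl_div n y q + \<Lambda> * kl_div n y (response n c \<Lambda> q v)
    \<le> reg_max n c \<Lambda> q v"
  using three_point_lagrangian[OF assms, of v "multiplier n c \<Lambda> q v"]
  by (simp add: reg_max_eq_lagrangian kl_div_def response_def)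

lemma reg_max_ge:
  assumes "y \<in> capped_simplex n c"
  shows "(\<Sum>i<n. y i * v i) - \<Lambda> * kl_div n y q \<le> reg_max n c \<Lambda> q v"
  using reg_max_three_point[OF assms, of v] kl_div_nonneg[OF assms response_in, of v]
    mult_nonneg_nonneg[of \<Lambda> "kl_div n y (response n c \<Lambda> q v)"] \<Lambda>_pos by linarith

lemma reg_max_le_lagrangian: "reg_max n c \<Lambda> q v \<le> lagrangian v \<nu>"
proof -
  have r: "response n c \<Lambda> q v \<in> capped_simplex n c"
    using response_in by (simp add: pos_capped_simplex_def)
  have "0 \<le> \<Lambda> * (\<Sum>i<n. kl_term (response n c \<Lambda> q v i) (capped_exp c \<Lambda> (q i) (v i - \<nu>)))"
    using r q_pos c_pos \<Lambda>_pos
    by (intro mult_nonneg_nonneg sum_nonneg kl_term_nonneg capped_exp_pos)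
       (auto simp: capped_simplex_def)
  then show ?thesis
    using three_point_lagrangian[OF r, of v \<nu>] by (simp add: reg_max_def)
qed

text \<open>Strong duality at any root of the mass, not only at the chosen multiplier; the descent
  argument compares with a root supplied by \<open>mass_root_near\<close>.\<close>

lemma lagrangian_le_reg_max:
  assumes "mass v \<nu> = 1"
  shows "lagrangian v \<nu> \<le> reg_max n c \<Lambda> q v"
proof -
  define y where "y = (\<lambda>i. if i < n then capped_exp c \<Lambda> (q i) (v i - \<nu>) else 0)"
  have "y \<in> capped_simplex n c"
    using assms q_pos c_pos
    by (auto simp: y_def capped_simplex_def capped_exp_le intro!: less_imp_le[OF capped_exp_pos])
  from reg_max_ge[OF this, of v] show ?thesis
    by (simp add: lagrangian_at_root[OF assms] y_def kl_div_def)
qed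

text \<open>The lagrangian is convex in \<open>\<nu>\<close> with slope
  \<open>1 - mass v \<nu>\<close>. The tangent at \<open>\<nu> + \<Lambda>\<close> bounds the mass
  there by the drop of the lagrangian, whose lower value is at least \<open>u\<close>. Then
  \<open>capped_exp_shift\<close> moves back to \<open>\<nu>\<close>, and \<open>3\<close> bounds
  \<open>exp 1\<close>.\<close>

lemma mass_le_lagrangian_gap:
  assumes "u \<le> reg_max n c \<Lambda> q v"
  shows "mass v \<nu> \<le> 3 * (1 + (lagrangian v \<nu> - u) / \<Lambda>)"
proof -
  have "exp 1 * mass v (\<nu> + \<Lambda>) \<le> 3 * mass v (\<nu> + \<Lambda>)"
    using exp_le by (intro mult_right_mono sum_nonneg less_imp_le[OF capped_exp_pos])
      (auto simp: c_pos q_pos)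
  moreover have "mass v \<nu> \<le> exp 1 * mass v (\<nu> + \<Lambda>)"
    unfolding sum_distrib_left
    using capped_exp_shift[OF \<Lambda>_pos c_pos] by (intro sum_mono) (simp only: diff_diff_eq[symmetric])
  moreover have "(\<Sum>i<n. capped_conj c \<Lambda> (q i) (v i - (\<nu> + \<Lambda>))
        + capped_exp c \<Lambda> (q i) (v i - (\<nu> + \<Lambda>)) * (v i - \<nu> - (v i - (\<nu> + \<Lambda>))))
      \<le> (\<Sum>i<n. capped_conj c \<Lambda> (q i) (v i - \<nu>))"
    using q_pos c_pos \<Lambda>_pos by (intro sum_mono capped_conj_subgradient) auto
  then have "\<Lambda> * mass v (\<nu> + \<Lambda>) \<le> lagrangian v \<nu> - lagrangian v (\<nu> + \<Lambda>) + \<Lambda>"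
    by (simp add: sum.distrib sum_distrib_left mult.commute)
  then have "\<Lambda> * mass v (\<nu> + \<Lambda>) \<le> \<Lambda> + (lagrangian v \<nu> - u)"
    using reg_max_le_lagrangian[of v "\<nu> + \<Lambda>"] assms by linarith
  then have "mass v (\<nu> + \<Lambda>) \<le> 1 + (lagrangian v \<nu> - u) / \<Lambda>"
    using \<Lambda>_pos by (simp add: field_simps)
  then have "3 * mass v (\<nu> + \<Lambda>) \<le> 3 * (1 + (lagrangian v \<nu> - u) / \<Lambda>)"
    by (rule mult_left_mono) simp
  ultimately show ?thesis by (meson order_trans)
qed

text \<open>The mass is monotone, so a shift of \<open>\<nu>\<close> by \<open>D\<close> outweighs
  any change of the entries by \<open>D\<close>.\<close>

lemma mass_root_near:
  assumes "\<And>i. i < n \<Longrightarrow> \<bar>w i - v i\<bar> \<le> D" "0 \<le> D" "mass v \<nu> = 1"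
  obtains \<mu> where "\<bar>\<mu> - \<nu>\<bar> \<le> D" "mass w \<mu> = 1"
proof -
  have "mass v \<nu> \<le> mass w (\<nu> - D)"
    using assms(1) q_pos \<Lambda>_pos by (intro sum_mono capped_exp_mono) (force simp: abs_le_iff)+
  moreover have "mass w (\<nu> + D) \<le> mass v \<nu>"
    using assms(1) q_pos \<Lambda>_pos by (intro sum_mono capped_exp_mono) (force simp: abs_le_iff)+
  ultimately obtain \<mu> where "\<nu> - D \<le> \<mu>" "\<mu> \<le> \<nu> + D" "mass w \<mu> = 1"
    using mass_root_between[of "\<nu> - D" "\<nu> + D" w] assms by auto
  then show thesis using that[of \<mu>] by (simp add: abs_le_iff)
qed

lemma reg_max_diff_le:
  assumes "\<And>i. i < n \<Longrightarrow> \<bar>v i - w i\<bar> \<le> D"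
  shows "reg_max n c \<Lambda> q v - reg_max n c \<Lambda> q w \<le> D"
proof -
  define y where "y = response n c \<Lambda> q v"
  have y: "y \<in> capped_simplex n c"
    using response_in by (simp add: y_def pos_capped_simplex_def)
  have "(\<Sum>i<n. y i * v i) - (\<Sum>i<n. y i * w i) = (\<Sum>i<n. y i * (v i - w i))"
    by (simp add: right_diff_distrib sum_subtractf)
  also have "\<dots> \<le> (\<Sum>i<n. y i * D)"
    using y assms by (intro sum_mono mult_left_mono) (auto simp: capped_simplex_def abs_le_iff)
  also have "\<dots> = D" using y by (simp add: capped_simplex_def sum_distrib_right[symmetric])
  finally show ?thesis
    using reg_max_ge[OF y, of w] by (simp add: reg_max_def[of n c \<Lambda> q v] y_def[symmetric])
qed

text \<open>Test the three-point inequality of each response against the other and add. The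
  regularizers cancel, which bounds the symmetrized divergence by the pairing of
  \<open>z - y\<close> with \<open>w - v\<close>. The left side is quadratic in the l1 distance, the
  right side linear.\<close>

lemma response_l1_lipschitz:
  assumes "\<And>i. i < n \<Longrightarrow> \<bar>w i - v i\<bar> \<le> D"
  shows "(\<Sum>i<n. \<bar>response n c \<Lambda> q w i - response n c \<Lambda> q v i\<bar>) \<le> 2 * D / \<Lambda>"
proof -
  define y where "y = response n c \<Lambda> q v"
  define z where "z = response n c \<Lambda> q w"
  define s where "s = (\<Sum>i<n. \<bar>z i - y i\<bar>)"
  have yp: "y \<in> pos_capped_simplex n c" and zp: "z \<in> pos_capped_simplex n c"
    by (simp_all add: y_def z_def response_in)
  then have y: "y \<in> capped_simplex n c" and z: "z \<in> capped_simplex n c"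
    by (simp_all add: pos_capped_simplex_def)
  have s0: "0 \<le> s" by (simp add: s_def sum_nonneg)
  have "s\<^sup>2 \<le> 4 * kl_div n z y" unfolding s_def by (rule l1_sq_le_kl_div[OF z yp])
  moreover have "s\<^sup>2 \<le> 4 * kl_div n y z"
    unfolding s_def using l1_sq_le_kl_div[OF y zp] by (simp add: abs_minus_commute)
  ultimately have "s\<^sup>2 \<le> 2 * (kl_div n z y + kl_div n y z)" by (simp add: distrib_left)
  then have "\<Lambda> * s\<^sup>2 \<le> 2 * (\<Lambda> * kl_div n z y + \<Lambda> * kl_div n y z)"
    using mult_left_mono[of "s\<^sup>2" "2 * (kl_div n z y + kl_div n y z)" \<Lambda>] \<Lambda>_pos
    by (simp add: algebra_simps)
  moreover have "\<Lambda> * kl_div n z y + \<Lambda> * kl_div n y z \<le> (\<Sum>i<n. (z i - y i) * (w i - v i))"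
    using reg_max_three_point[OF z, of v] reg_max_three_point[OF y, of w]
    by (simp add: reg_max_def y_def[symmetric] z_def[symmetric] algebra_simps sum_subtractf sum.distrib)
  moreover have "(\<Sum>i<n. (z i - y i) * (w i - v i)) \<le> (\<Sum>i<n. \<bar>z i - y i\<bar> * D)"
  proof (intro sum_mono)
    fix i assume "i \<in> {..<n}"
    then have "\<bar>z i - y i\<bar> * \<bar>w i - v i\<bar> \<le> \<bar>z i - y i\<bar> * D"
      using assms by (intro mult_left_mono) auto
    then show "(z i - y i) * (w i - v i) \<le> \<bar>z i - y i\<bar> * D"
      by (metis abs_ge_self abs_mult order_trans)
  qed
  ultimately have le: "\<Lambda> * s\<^sup>2 \<le> 2 * (s * D)"
    by (simp add: s_def sum_distrib_right)
  have "\<Lambda> * s \<le> 2 * D"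
  proof (cases "s = 0")
    case True
    have "n \<noteq> 0" using q_sum by (cases n) auto
    then have "0 \<le> D" using assms[of 0] by (meson abs_ge_zero neq0_conv order_trans)
    with True show ?thesis by simp
  next
    case False
    with s0 have "0 < s" by simp
    from le have "s * (\<Lambda> * s) \<le> s * (2 * D)" by (simp add: power2_eq_square algebra_simps)
    with \<open>0 < s\<close> show ?thesis by (simp only: mult_le_cancel_left_pos)
  qed
  then show ?thesis
    using \<Lambda>_pos by (simp add: s_def z_def y_def field_simps)
qed

end

section \<open>Compact convex sets of coordinate vectors\<close>

definition sq_dist :: "nat \<Rightarrow> rvec \<Rightarrow> rvec \<Rightarrow> real"
  where "sq_dist d x y = (\<Sum>j<d. (x j - y j)\<^sup>2)"

text \<open>The projection, specified by the property that the descent uses;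
  \<open>nearest_exists\<close> derives it for the closest point.\<close>

definition nearest :: "nat \<Rightarrow> rvec set \<Rightarrow> rvec \<Rightarrow> rvec"
  where "nearest d X z = (SOME p. p \<in> X \<and> (\<forall>x\<in>X. sq_dist d p x \<le> sq_dist d z x))"

lemma l2_dist_sq: "(l2_dist d x y)\<^sup>2 = sq_dist d x y"
  by (simp add: l2_dist_def L2_set_def sq_dist_def sum_nonneg)

lemma l2_dist_nonneg: "0 \<le> l2_dist d x y"
  by (simp add: l2_dist_def)

text \<open>In the product topology Tychonoff makes the box around \<open>x0\<close>, with zero from
  coordinate \<open>d\<close> on, compact; \<open>X\<close> is a closed subset of it.\<close>

lemma compact_if_l2_bounded:
  assumes X: "closedin (Euclidean_space d) X" and R: "\<And>x y. x \<in> X \<Longrightarrow> y \<in> X \<Longrightarrow> l2_dist d x y \<le> R"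
  shows "compact X"
proof (cases "X = {}")
  case False
  then obtain x0 where x0: "x0 \<in> X" by blast
  define K where "K j = (if j < d then {x0 j - R .. x0 j + R} else {0})" for j
  have "compactin (powertop_real UNIV) (PiE UNIV K)"
    by (simp add: compactin_PiE K_def)
  then have "compact (PiE UNIV K)" by (simp add: euclidean_product_topology)
  moreover have "closed X" using X by (simp add: closedin_Euclidean_space_iff)
  ultimately have "compact (PiE UNIV K \<inter> X)" by (rule compact_Int_closed)
  moreover have "X \<subseteq> PiE UNIV K"
  proof
    fix x assume x: "x \<in> X"
    have "x j \<in> K j" for j
    proof (cases "j < d")
      case True
      have "\<bar>x j - x0 j\<bar> = sqrt ((x j - x0 j)\<^sup>2)" by simp
      also have "\<dots> \<le> l2_dist d x x0"
        unfolding l2_dist_def L2_set_def using True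
        by (intro real_sqrt_le_mono member_le_sum) auto
      also have "\<dots> \<le> R" using R x x0 by blast
      finally show ?thesis using True by (auto simp: K_def abs_le_iff)
    next
      case False
      then show ?thesis using x X by (auto simp: K_def closedin_Euclidean_space_iff topspace_Euclidean_space)
    qed
    then show "x \<in> PiE UNIV K" by auto
  qed
  ultimately show ?thesis by (simp add: Int_absorb1)
qed simp

lemma nonneg_if_perturbation_nonneg:
  fixes a b :: real
  assumes "\<And>t. 0 < t \<Longrightarrow> t \<le> 1 \<Longrightarrow> 0 \<le> a + t * b"
  shows "0 \<le> a"
proof (rule tendsto_lowerbound)
  show "((\<lambda>t. a + t * b) \<longlongrightarrow> a) (at_right 0)"
    by (auto intro!: tendsto_eq_intros)
  show "\<forall>\<^sub>F t in at_right 0. 0 \<le> a + t * b"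
    using eventually_at_right_real[OF zero_less_one]
    by eventually_elim (auto intro!: assms)
qed simp

text \<open>Moving from the closest point \<open>p\<close> towards \<open>x\<close> cannot reduce
  the distance to \<open>z\<close>, so the derivative \<open>2 * a\<close> is nonnegative. It is
  also the cross term when \<open>sq_dist d z x\<close> is expanded around \<open>p\<close>.\<close>

lemma nearest_exists:
  assumes "compact X" "X \<noteq> {}" "convex_vset X"
  shows "\<exists>p. p \<in> X \<and> (\<forall>x\<in>X. sq_dist d p x \<le> sq_dist d z x)"
proof -
  have "continuous_on X (\<lambda>x. sq_dist d x z)"
    unfolding sq_dist_def
    by (intro continuous_intros continuous_on_subset[OF continuous_on_product_coordinates]) auto
  from continuous_attains_inf[OF assms(1,2) this]
  obtain p where p: "p \<in> X" "\<And>x. x \<in> X \<Longrightarrow> sq_dist d p z \<le> sq_dist d x z" by blast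
  have "sq_dist d p x \<le> sq_dist d z x" if x: "x \<in> X" for x
  proof -
    define a where "a = (\<Sum>j<d. (p j - z j) * (x j - p j))"
    have "0 \<le> 2 * a + t * sq_dist d x p" if t: "0 < t" "t \<le> 1" for t
    proof -
      have "segment_point t p x \<in> X"
        using assms(3) p(1) x t by (auto simp: convex_vset_def)
      then have "sq_dist d p z \<le> sq_dist d (segment_point t p x) z" by (rule p)
      also have "\<dots> = (\<Sum>j<d. (p j - z j)\<^sup>2 + t * (2 * ((p j - z j) * (x j - p j)) + t * (x j - p j)\<^sup>2))"
        unfolding sq_dist_def segment_point_def
        by (intro sum.cong) (auto simp: power2_eq_square algebra_simps)
      also have "\<dots> = sq_dist d p z + t * (2 * a + t * sq_dist d x p)"
        by (simp add: sq_dist_def a_def sum.distrib sum_distrib_left[symmetric])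
      finally show ?thesis using t by (simp add: zero_le_mult_iff)
    qed
    from nonneg_if_perturbation_nonneg[OF this] have "0 \<le> a" by simp
    moreover have "sq_dist d z x = sq_dist d p z + 2 * a + sq_dist d p x"
      unfolding sq_dist_def a_def sum_distrib_left sum.distrib[symmetric]
      by (intro sum.cong) (auto simp: power2_eq_square algebra_simps)
    moreover have "0 \<le> sq_dist d p z" by (simp add: sq_dist_def sum_nonneg)
    ultimately show ?thesis by linarith
  qed
  with p(1) show ?thesis by blast
qed

lemma
  assumes "compact X" "X \<noteq> {}" "convex_vset X"
  shows nearest_in: "nearest d X z \<in> X"
    and sq_dist_nearest_le: "x \<in> X \<Longrightarrow> sq_dist d (nearest d X z) x \<le> sq_dist d z x"
  using someI_ex[OF nearest_exists[OF assms, of d z]] by (auto simp: nearest_def)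

text \<open>Test the subgradient inequality at \<open>x + v\<close>: the increase is at least the
  squared norm of \<open>v\<close> and at most \<open>G\<close> times the norm.\<close>

lemma subgradient_norm_le:
  assumes "l2_lipschitz d G h" "is_subgradient d h x v" "x \<in> Rspace d"
  shows "(\<Sum>j<d. (v j)\<^sup>2) \<le> G\<^sup>2"
proof -
  define s where "s = L2_set v {..<d}"
  have v: "v \<in> Rspace d" using assms(2) by (simp add: is_subgradient_def)
  have z: "(\<lambda>j. x j + v j) \<in> Rspace d"
    using assms(3) v by (auto simp: topspace_Euclidean_space)
  have s2: "s\<^sup>2 = (\<Sum>j<d. (v j)\<^sup>2)" by (simp add: s_def L2_set_def sum_nonneg)
  have "h x + (\<Sum>j<d. v j * (x j + v j - x j)) \<le> h (\<lambda>j. x j + v j)"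
    using assms(2) z by (auto simp only: is_subgradient_def dest!: bspec[OF _ z])
  then have "s\<^sup>2 \<le> h (\<lambda>j. x j + v j) - h x" unfolding s2 by (simp add: power2_eq_square)
  also have "\<dots> \<le> \<bar>h (\<lambda>j. x j + v j) - h x\<bar>" by simp
  also have "\<dots> \<le> G * l2_dist d (\<lambda>j. x j + v j) x"
    using assms(1,3) z by (auto simp: l2_lipschitz_def)
  also have "\<dots> = G * s" by (simp add: l2_dist_def s_def)
  finally have "s * s \<le> G * s" by (simp add: power2_eq_square)
  moreover have "0 \<le> s" by (simp add: s_def)
  moreover have "0 \<le> G" using assms(1) by (simp add: l2_lipschitz_def)
  ultimately have "s \<le> G" by (cases "s = 0") auto
  then show ?thesis using \<open>0 \<le> s\<close> unfolding s2[symmetric] by (simp add: power_mono)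
qed

section \<open>Query algorithms\<close>

definition expected_output ::
    "(nat \<Rightarrow> rvec \<Rightarrow> real \<times> rvec) \<Rightarrow> (rvec \<Rightarrow> real) \<Rightarrow> query_alg \<Rightarrow> real"
  where "expected_output orc \<phi> A = measure_pmf.expectation (map_pmf snd (run_alg orc A)) \<phi>"

text \<open>Finite support is included because it supplies the integrability needed to split the
  expectation of a uniform choice into an average.\<close>

definition query_bound ::
    "(nat \<Rightarrow> rvec \<Rightarrow> real \<times> rvec) \<Rightarrow> (nat \<times> rvec) set \<Rightarrow> rvec set \<Rightarrow> nat \<Rightarrow> query_alg \<Rightarrow> bool"
  where "query_bound orc Q Y N A \<longleftrightarrow> finite (set_pmf (run_alg orc A)) \<and>
    (\<forall>(qs, y)\<in>set_pmf (run_alg orc A). set qs \<subseteq> Q \<and> length qs \<le> N \<and> y \<in> Y)"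

definition uniform_choice :: "nat \<Rightarrow> (nat \<Rightarrow> query_alg) \<Rightarrow> query_alg"
  where "uniform_choice m F = Sample (map_pmf F (pmf_of_set {..<m}))"

primrec query_all :: "nat list \<Rightarrow> rvec \<Rightarrow> rvec \<Rightarrow> (rvec \<Rightarrow> query_alg) \<Rightarrow> query_alg"
  where
    "query_all [] x v k = k v"
  | "query_all (i # is) x v k = Query i x (\<lambda>a. query_all is x (v(i := fst a)) k)"

primrec sgd_loop ::
    "nat \<Rightarrow> (nat \<Rightarrow> real \<times> rvec \<Rightarrow> rvec \<times> real \<Rightarrow> rvec \<times> real) \<Rightarrow> nat \<Rightarrow> rvec \<times> real \<Rightarrow>
      (rvec \<times> real \<Rightarrow> query_alg) \<Rightarrow> query_alg"
  where
    "sgd_loop n st 0 z k = k z"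
  | "sgd_loop n st (Suc t) z k =
       uniform_choice n (\<lambda>i. Query i (fst z) (\<lambda>a. sgd_loop n st t (st i a z) k))"

text \<open>Finite averages instead of pmf expectations spare the descent argument any integrability.\<close>

primrec walk_mean :: "nat \<Rightarrow> (nat \<Rightarrow> 'a \<Rightarrow> 'a) \<Rightarrow> nat \<Rightarrow> ('a \<Rightarrow> real) \<Rightarrow> 'a \<Rightarrow> real"
  where
    "walk_mean n s 0 u z = u z"
  | "walk_mean n s (Suc t) u z = (\<Sum>i<n. walk_mean n s t u (s i z)) / real n"

lemma query_bound_mono: "query_bound orc Q Y N A \<Longrightarrow> N \<le> N' \<Longrightarrow> query_bound orc Q Y N' A"
  by (fastforce simp: query_bound_def)

lemma query_bound_Output: "y \<in> Y \<Longrightarrow> query_bound orc Q Y N (Output y)"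
  by (simp add: query_bound_def)

lemma query_bound_Query:
  "(i, x) \<in> Q \<Longrightarrow> query_bound orc Q Y N (k (orc i x)) \<Longrightarrow> query_bound orc Q Y (Suc N) (Query i x k)"
  by (fastforce simp: query_bound_def)

lemma query_bound_uniform_choice:
  assumes "1 \<le> m" "\<And>i. i < m \<Longrightarrow> query_bound orc Q Y N (F i)"
  shows "query_bound orc Q Y N (uniform_choice m F)"
proof -
  have "set_pmf (pmf_of_set {..<m}) = {..<m}"
    using assms(1) by (intro set_pmf_of_set) (auto simp: lessThan_empty_iff)
  then have "set_pmf (run_alg orc (uniform_choice m F)) = (\<Union>i<m. set_pmf (run_alg orc (F i)))"
    by (simp add: uniform_choice_def join_eq_bind_pmf bind_map_pmf map_pmf_comp)
  with assms(2) show ?thesis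
    unfolding query_bound_def by auto
qed

lemma expected_output_Output [simp]: "expected_output orc \<phi> (Output y) = \<phi> y"
  by (simp add: expected_output_def)

lemma expected_output_Query [simp]:
  "expected_output orc \<phi> (Query i x k) = expected_output orc \<phi> (k (orc i x))"
  by (simp add: expected_output_def case_prod_beta)

lemma expected_output_uniform_choice:
  assumes "1 \<le> m" "\<And>i. i < m \<Longrightarrow> query_bound orc Q Y N (F i)"
  shows "expected_output orc \<phi> (uniform_choice m F) =
    (\<Sum>i<m. expected_output orc \<phi> (F i)) / real m"
proof -
  have "measure_pmf.expectation (pmf_of_set {..<m} \<bind> (\<lambda>i. map_pmf snd (run_alg orc (F i)))) \<phi>
      = (\<Sum>i<m. measure_pmf.expectation (map_pmf snd (run_alg orc (F i))) \<phi> /\<^sub>R real (card {..<m}))"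
    using assms by (intro pmf_expectation_bind_pmf_of_set) (auto simp: query_bound_def lessThan_empty_iff)
  moreover have "map_pmf snd (run_alg orc (uniform_choice m F)) =
      pmf_of_set {..<m} \<bind> (\<lambda>i. map_pmf snd (run_alg orc (F i)))"
    by (simp add: uniform_choice_def map_join_pmf map_pmf_comp join_eq_bind_pmf bind_map_pmf map_bind_pmf)
  ultimately show ?thesis
    by (simp only: expected_output_def card_lessThan divide_inverse real_scaleR_def
        sum_distrib_right[symmetric] mult.commute[of "inverse _"])
qed

lemma query_all_correct:
  "expected_output (first_order_oracle f g) \<phi> (query_all is x v k) =
     expected_output (first_order_oracle f g) \<phi> (k (\<lambda>i. if i \<in> set is then f i x else v i))"
proof (induction "is" arbitrary: v)
  case (Cons i "is")
  have "(\<lambda>j. if j \<in> set is then f j x else (v(i := f i x)) j) =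
      (\<lambda>j. if j \<in> set (i # is) then f j x else v j)" by auto
  then show ?case
    using Cons.IH[of "v(i := f i x)"] by (simp only: first_order_oracle_def
        query_all.simps expected_output_Query fst_conv)
qed simp

lemma query_bound_query_all:
  assumes "set is \<times> {x} \<subseteq> Q"
    and "query_bound (first_order_oracle f g) Q Y N (k (\<lambda>i. if i \<in> set is then f i x else v i))"
  shows "query_bound (first_order_oracle f g) Q Y (length is + N) (query_all is x v k)"
  using assms
proof (induction "is" arbitrary: v)
  case (Cons i "is")
  have "(\<lambda>j. if j \<in> set is then f j x else (v(i := f i x)) j) =
      (\<lambda>j. if j \<in> set (i # is) then f j x else v j)" by auto
  then have "query_bound (first_order_oracle f g) Q Y (length is + N)
      (query_all is x (v(i := f i x)) k)"
    using Cons.prems by (intro Cons.IH) (auto simp only: list.set)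
  moreover have "(i, x) \<in> Q" using Cons.prems(1) by simp
  moreover have "fst (first_order_oracle f g i x) = f i x" by (simp add: first_order_oracle_def)
  ultimately show ?case
    by (simp only: query_all.simps list.size(4) add_Suc_right add_0_right add_Suc query_bound_Query)
qed simp

lemma query_bound_sgd_loop:
  assumes n: "1 \<le> n" and Q: "\<And>i z. i < n \<Longrightarrow> z \<in> S \<Longrightarrow> (i, fst z) \<in> Q"
    and st: "\<And>i z. i < n \<Longrightarrow> z \<in> S \<Longrightarrow> st i (orc i (fst z)) z \<in> S"
    and k: "\<And>z. z \<in> S \<Longrightarrow> query_bound orc Q Y N (k z)" and z: "z \<in> S"
  shows "query_bound orc Q Y (t + N) (sgd_loop n st t z k)"
  using z
proof (induction t arbitrary: z)
  case (Suc t)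
  show ?case
    unfolding sgd_loop.simps add_Suc
    by (intro query_bound_uniform_choice query_bound_Query n Q Suc.IH st Suc.prems)
qed (simp add: k)

lemma expected_output_sgd_loop:
  assumes n: "1 \<le> n" and Q: "\<And>i z. i < n \<Longrightarrow> z \<in> S \<Longrightarrow> (i, fst z) \<in> Q"
    and st: "\<And>i z. i < n \<Longrightarrow> z \<in> S \<Longrightarrow> st i (orc i (fst z)) z \<in> S"
    and k: "\<And>z. z \<in> S \<Longrightarrow> query_bound orc Q Y N (k z)" and z: "z \<in> S"
  shows "expected_output orc \<phi> (sgd_loop n st t z k) =
    walk_mean n (\<lambda>i z. st i (orc i (fst z)) z) t (\<lambda>z. expected_output orc \<phi> (k z)) z"
  using z
proof (induction t arbitrary: z)
  case (Suc t)
  have "query_bound orc Q Y (Suc (t + N)) (Query i (fst z) (\<lambda>a. sgd_loop n st t (st i a z) k))"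
    if "i < n" for i
    using st Suc.prems that Q
    by (intro query_bound_Query query_bound_sgd_loop[where S = S and n = n]) (auto intro: n Q st k)
  from expected_output_uniform_choice[OF n this] show ?case
    using st Suc by simp
qed simp

lemma walk_mean_mono:
  assumes "\<And>i z. i < n \<Longrightarrow> z \<in> S \<Longrightarrow> s i z \<in> S" "\<And>z. z \<in> S \<Longrightarrow> u z \<le> w z" "z \<in> S"
  shows "walk_mean n s t u z \<le> walk_mean n s t w z"
  using assms(3) by (induction t arbitrary: z) (auto intro!: divide_right_mono sum_mono assms)

lemma walk_mean_affine:
  assumes "1 \<le> n"
  shows "walk_mean n s t (\<lambda>z. a + b * u z) z = a + b * walk_mean n s t u z"
  using assms
  by (induction t arbitrary: z)
     (auto simp: sum.distrib sum_distrib_left[symmetric] add_divide_distrib)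

text \<open>The drift telescopes along the walk, and nonnegativity of \<open>W\<close> discards the
  final potential. The induction peels off the first step, where \<open>walk_mean\<close>
  recurses.\<close>

lemma walk_mean_sum_le_potential:
  assumes n: "1 \<le> n" and S: "\<And>i z. i < n \<Longrightarrow> z \<in> S \<Longrightarrow> s i z \<in> S"
    and W: "\<And>z. z \<in> S \<Longrightarrow> 0 \<le> W z"
    and drift: "\<And>z. z \<in> S \<Longrightarrow> (\<Sum>i<n. W (s i z)) / real n \<le> W z - u z + b"
    and z: "z \<in> S"
  shows "(\<Sum>t<T. walk_mean n s t u z) \<le> W z + real T * b"
  using z
proof (induction T arbitrary: z)
  case (Suc T)
  have "(\<Sum>t<Suc T. walk_mean n s t u z) = u z + (\<Sum>t<T. walk_mean n s (Suc t) u z)"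
    by (subst sum.lessThan_Suc_shift) simp
  also have "(\<Sum>t<T. walk_mean n s (Suc t) u z) =
      (\<Sum>i<n. \<Sum>t<T. walk_mean n s t u (s i z)) / real n"
    by (simp add: sum_divide_distrib[symmetric] sum.swap[of _ "{..<n}"])
  also have "\<dots> \<le> (\<Sum>i<n. W (s i z) + real T * b) / real n"
    using Suc S by (intro divide_right_mono sum_mono) auto
  also have "\<dots> = (\<Sum>i<n. W (s i z)) / real n + real T * b"
    using n by (simp add: sum.distrib add_divide_distrib)
  also have "\<dots> \<le> W z - u z + b + real T * b" using drift[OF Suc.prems] by simp
  finally show ?case by (simp add: algebra_simps)
qed (simp add: W)

section \<open>The regularized phases\<close>

text \<open>
  For \<open>G = 0\<close> the step size \<open>\<eta> / G\<^sup>2\<close> is \<open>0\<close>, which is right: then the subgradients vanish.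
\<close>

definition sgd_step ::
    "nat \<Rightarrow> nat \<Rightarrow> rvec set \<Rightarrow> real \<Rightarrow> real \<Rightarrow> real \<Rightarrow> real \<Rightarrow> rvec \<Rightarrow>
      nat \<Rightarrow> real \<times> rvec \<Rightarrow> rvec \<times> real \<Rightarrow> rvec \<times> real"
  where "sgd_step n d X G c \<eta> \<Lambda> q i a z =
    (let w = real n * capped_exp c \<Lambda> (q i) (fst a - snd z) in
      (nearest d X (\<lambda>j. fst z j - \<eta> / G\<^sup>2 * (w * snd a j)), snd z - \<eta> * (1 - w)))"

text \<open>Stopping after a uniformly random number of steps makes the expected gap at the stopping
  point the mean gap of the trajectory. \<open>v0\<close> stands for the values at
  \<open>x0\<close>, so the starting multiplier of a phase costs no further queries.\<close>

primrec phases ::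
    "nat \<Rightarrow> nat \<Rightarrow> rvec set \<Rightarrow> real \<Rightarrow> real \<Rightarrow> real \<Rightarrow> nat \<Rightarrow> rvec \<Rightarrow> rvec \<Rightarrow>
      nat \<Rightarrow> real \<Rightarrow> rvec \<Rightarrow> query_alg"
  where
    "phases n d X G c \<eta> T x0 v0 0 \<Lambda> q = Output q"
  | "phases n d X G c \<eta> T x0 v0 (Suc K) \<Lambda> q =
      uniform_choice T (\<lambda>\<tau>. sgd_loop n (sgd_step n d X G c \<eta> \<Lambda> q) \<tau> (x0, multiplier n c \<Lambda> q v0)
        (\<lambda>z. query_all [0..<n] (fst z) (\<lambda>_. 0)
          (\<lambda>v. phases n d X G c \<eta> T x0 v0 K (2 * \<Lambda>) (response n c \<Lambda> q v))))"

section \<open>The problem data and the dual objective\<close>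

locale cvar_problem =
  fixes n d :: nat and X :: "rvec set" and R G M \<alpha> :: real
    and f :: "nat \<Rightarrow> rvec \<Rightarrow> real" and g :: "nat \<Rightarrow> rvec \<Rightarrow> rvec"
  assumes n_ge: "1 \<le> n" and X_nonempty: "X \<noteq> {}" and X_closed: "closedin (Euclidean_space d) X"
    and X_convex: "convex_vset X" and X_diameter: "\<And>x y. x \<in> X \<Longrightarrow> y \<in> X \<Longrightarrow> l2_dist d x y \<le> R"
    and f_convex: "\<And>i. i < n \<Longrightarrow> convex_fun_on (Rspace d) (f i)"
    and f_lipschitz: "\<And>i. i < n \<Longrightarrow> l2_lipschitz d G (f i)"
    and f_range: "\<And>i x. i < n \<Longrightarrow> x \<in> X \<Longrightarrow> f i x \<in> {0..M}"
    and g_subgradient: "\<And>i x. i < n \<Longrightarrow> x \<in> X \<Longrightarrow> is_subgradient d (f i) x (g i x)"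
    and \<alpha>_ge: "1 / real n \<le> \<alpha>" and \<alpha>_le: "\<alpha> \<le> 1"
begin

abbreviation "cap \<equiv> 1 / (\<alpha> * real n)"
abbreviation "oracle \<equiv> first_order_oracle f g"
abbreviation "\<phi> \<equiv> dual_objective n X f"

definition vals :: "rvec \<Rightarrow> rvec"
  where "vals x = (\<lambda>i. if i < n then f i x else 0)"

lemma vals_apply [simp]: "i < n \<Longrightarrow> vals x i = f i x"
  by (simp add: vals_def)

declare sum.cong_simp [cong]
  \<comment> \<open>so that \<open>vals x i\<close> simplifies to \<open>f i x\<close> under sums over \<open>i < n\<close>\<close>

lemma \<alpha>_pos: "0 < \<alpha>"
  using \<alpha>_ge n_ge by (smt (verit) divide_pos_pos of_nat_1 of_nat_mono zero_less_one)

lemma cap_pos: "0 < cap"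
  using \<alpha>_pos n_ge by simp

lemma X_subset: "x \<in> X \<Longrightarrow> x \<in> Rspace d"
  using closedin_subset[OF X_closed] by blast

lemma X_compact: "compact X"
  using compact_if_l2_bounded X_closed X_diameter by blast

lemma G_nonneg: "0 \<le> G"
  using f_lipschitz[of 0] n_ge by (simp add: l2_lipschitz_def)

lemma R_nonneg: "0 \<le> R"
  using X_nonempty X_diameter l2_dist_nonneg order_trans by (metis ex_in_conv)

lemma M_nonneg: "0 \<le> M"
  using X_nonempty f_range[of 0] n_ge by fastforce

lemma f_diff_le:
  "i < n \<Longrightarrow> x \<in> X \<Longrightarrow> y \<in> X \<Longrightarrow> \<bar>f i x - f i y\<bar> \<le> G * l2_dist d x y"
  using f_lipschitz X_subset unfolding l2_lipschitz_def by blast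

lemma f_diff_le_diameter:
  assumes "i < n" "x \<in> X" "y \<in> X"
  shows "\<bar>f i x - f i y\<bar> \<le> G * R"
  using f_diff_le[OF assms] mult_left_mono[OF X_diameter[OF assms(2,3)] G_nonneg] by linarith

lemma segment_in_X: "x \<in> X \<Longrightarrow> y \<in> X \<Longrightarrow> 0 \<le> t \<Longrightarrow> t \<le> 1 \<Longrightarrow> segment_point t x y \<in> X"
  using X_convex by (auto simp: convex_vset_def)

lemma f_segment_le:
  "i < n \<Longrightarrow> x \<in> X \<Longrightarrow> y \<in> X \<Longrightarrow> 0 \<le> t \<Longrightarrow> t \<le> 1 \<Longrightarrow>
    f i (segment_point t x y) \<le> (1 - t) * f i x + t * f i y"
  using f_convex X_subset unfolding convex_fun_on_def by auto

lemma l2_dist_segment: "0 \<le> t \<Longrightarrow> l2_dist d (segment_point t x y) x = t * l2_dist d y x"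
proof -
  assume t: "0 \<le> t"
  have "l2_dist d (segment_point t x y) x = L2_set (\<lambda>j. t * (y j - x j)) {..<d}"
    by (simp add: l2_dist_def segment_point_def algebra_simps)
  also have "\<dots> = t * l2_dist d y x"
    using t by (simp add: l2_dist_def L2_set_left_distrib L2_set_right_distrib)
  finally show ?thesis .
qed

lemma dual_objective_ge:
  "(\<And>x. x \<in> X \<Longrightarrow> b \<le> (\<Sum>i<n. p i * f i x)) \<Longrightarrow> b \<le> \<phi> p"
  unfolding dual_objective_def using X_nonempty by (rule cINF_greatest)

lemma dual_objective_le:
  assumes "p \<in> capped_simplex n cap" "x \<in> X"
  shows "\<phi> p \<le> (\<Sum>i<n. p i * f i x)"
  unfolding dual_objective_def
proof (rule cINF_lower[OF bdd_belowI2[where m = 0] assms(2)])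
  fix x assume "x \<in> X"
  then show "0 \<le> (\<Sum>i<n. p i * f i x)"
    using assms(1) f_range by (intro sum_nonneg mult_nonneg_nonneg) (auto simp: capped_simplex_def)
qed

lemma payoff_diff_le:
  assumes "x \<in> X"
  shows "(\<Sum>i<n. p i * f i x) - (\<Sum>i<n. q i * f i x) \<le> M * (\<Sum>i<n. \<bar>p i - q i\<bar>)"
proof -
  have "(\<Sum>i<n. p i * f i x) - (\<Sum>i<n. q i * f i x) = (\<Sum>i<n. (p i - q i) * f i x)"
    by (simp add: left_diff_distrib sum_subtractf)
  also have "\<dots> \<le> (\<Sum>i<n. M * \<bar>p i - q i\<bar>)"
  proof (intro sum_mono)
    fix i assume "i \<in> {..<n}"
    then have "0 \<le> f i x" "f i x \<le> M" using f_range assms by auto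
    then have "(p i - q i) * f i x \<le> \<bar>p i - q i\<bar> * M"
      by (intro mult_mono) auto
    then show "(p i - q i) * f i x \<le> M * \<bar>p i - q i\<bar>" by (simp add: mult.commute)
  qed
  finally show ?thesis by (simp add: sum_distrib_left)
qed

text \<open>Replacing \<open>p\<close> by \<open>q\<close> costs at most \<open>M\<close> times
  their l1 distance \<open>s\<close>. Young's inequality splits this into
  \<open>\<Lambda> * s^2 / 4\<close>, which the l1 bound turns into the divergence, and
  \<open>M^2 / \<Lambda>\<close>. This closes the chain of phases.\<close>

lemma dual_objective_diff_le:
  assumes p: "p \<in> capped_simplex n cap" and q: "q \<in> pos_capped_simplex n cap" and \<Lambda>: "0 < \<Lambda>"
  shows "\<phi> p \<le> \<phi> q + \<Lambda> * kl_div n p q + M\<^sup>2 / \<Lambda>"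
proof -
  define s where "s = (\<Sum>i<n. \<bar>p i - q i\<bar>)"
  have "s\<^sup>2 \<le> 4 * kl_div n p q" unfolding s_def by (rule l1_sq_le_kl_div[OF p q])
  then have kl: "\<Lambda> * s\<^sup>2 \<le> \<Lambda> * (4 * kl_div n p q)" using \<Lambda> by (intro mult_left_mono) auto
  have "0 \<le> (\<Lambda> * s - 2 * M)\<^sup>2 / (4 * \<Lambda>)" using \<Lambda> by simp
  also have "\<dots> = \<Lambda> * s\<^sup>2 / 4 - M * s + M\<^sup>2 / \<Lambda>"
    using \<Lambda> by (simp add: power2_eq_square field_simps)
  finally have Ms: "M * s \<le> \<Lambda> * kl_div n p q + M\<^sup>2 / \<Lambda>" using kl by simp
  have "\<phi> p - M * s \<le> \<phi> q"
  proof (rule dual_objective_ge)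
    fix x assume x: "x \<in> X"
    show "\<phi> p - M * s \<le> (\<Sum>i<n. q i * f i x)"
      using dual_objective_le[OF p x] payoff_diff_le[OF x, of p q] by (simp add: s_def)
  qed
  with Ms show ?thesis by linarith
qed

end

section \<open>The regularized game of one phase\<close>

locale cvar_phase = cvar_problem + capped_reg n "1 / (\<alpha> * real n)" \<Lambda> q for \<Lambda> q
begin

abbreviation "resp x \<equiv> response n cap \<Lambda> q (vals x)"
abbreviation "primal x \<equiv> reg_max n cap \<Lambda> q (vals x)"

lemma resp_in: "resp x \<in> capped_simplex n cap"
  using response_in by (simp add: pos_capped_simplex_def)

lemma primal_continuous: "continuous_on X primal"
  unfolding continuous_on_def
proof
  fix x assume x: "x \<in> X"
  have "continuous_on X (\<lambda>y. G * l2_dist d y x)"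
    unfolding l2_dist_def L2_set_def
    by (intro continuous_intros continuous_on_subset[OF continuous_on_product_coordinates]) auto
  then have "((\<lambda>y. G * l2_dist d y x) \<longlongrightarrow> G * l2_dist d x x) (at x within X)"
    using x by (simp add: continuous_on_def)
  then have "((\<lambda>y. G * l2_dist d y x) \<longlongrightarrow> 0) (at x within X)"
    by (simp add: l2_dist_def L2_set_def)
  moreover have "\<forall>\<^sub>F y in at x within X. norm (primal y - primal x) \<le> G * l2_dist d y x"
    unfolding eventually_at_filter
  proof (intro always_eventually allI impI)
    fix y assume y: "y \<in> X"
    have "primal y - primal x \<le> G * l2_dist d y x"
      by (rule reg_max_diff_le) (use f_diff_le[OF _ y x] in simp)
    moreover have "primal x - primal y \<le> G * l2_dist d y x"
      by (rule reg_max_diff_le) (use f_diff_le[OF _ y x] in \<open>simp add: abs_minus_commute\<close>)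
    ultimately show "norm (primal y - primal x) \<le> G * l2_dist d y x"
      by (simp only: real_norm_def abs_le_iff minus_diff_eq)
  qed
  ultimately have "((\<lambda>y. primal y - primal x) \<longlongrightarrow> 0) (at x within X)"
    by (rule Lim_null_comparison[rotated])
  then show "(primal \<longlongrightarrow> primal x) (at x within X)" by (rule LIM_zero_cancel)
qed

text \<open>
  Minimax equality for the regularized game: moving from the primal minimizer \<open>xs\<close> towards \<open>x\<close>
  by a fraction \<open>t\<close> changes the best response by \<open>O(t)\<close>, so the best response at \<open>xs\<close> itself
  satisfies the bound up to \<open>O(t)\<close>.
\<close>

lemma regularized_saddle_point:
  obtains xs where "xs \<in> X"
    "\<And>x. x \<in> X \<Longrightarrow> primal xs \<le> (\<Sum>i<n. resp xs i * f i x) - \<Lambda> * kl_div n (resp xs) q"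
proof -
  from continuous_attains_inf[OF X_compact X_nonempty primal_continuous]
  obtain xs where xs: "xs \<in> X" and min: "\<And>x. x \<in> X \<Longrightarrow> primal xs \<le> primal x" by blast
  define p where "p = resp xs"
  have p: "p \<in> capped_simplex n cap" by (simp add: p_def resp_in)
  have "primal xs \<le> (\<Sum>i<n. p i * f i x) - \<Lambda> * kl_div n p q" if x: "x \<in> X" for x
  proof -
    have "0 \<le> (\<Sum>i<n. p i * f i x) - \<Lambda> * kl_div n p q - primal xs + t * (4 * M * (G * R) / \<Lambda>)"
      if t: "0 < t" "t \<le> 1" for t
    proof -
      define xt where "xt = segment_point t xs x"
      define y where "y = resp xt"
      have xt: "xt \<in> X" using segment_in_X[OF xs x] t by (simp add: xt_def)
      have y: "y \<in> capped_simplex n cap" by (simp add: y_def resp_in)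
      have "(\<Sum>i<n. y i * f i xt) \<le> (\<Sum>i<n. y i * ((1 - t) * f i xs + t * f i x))"
        using y t f_segment_le[OF _ xs x] unfolding xt_def
        by (intro sum_mono mult_left_mono) (auto simp: capped_simplex_def)
      also have "\<dots> = (1 - t) * (\<Sum>i<n. y i * f i xs) + t * (\<Sum>i<n. y i * f i x)"
        by (simp add: distrib_left sum.distrib sum_distrib_left mult.left_commute)
      finally have "primal xt \<le> (1 - t) * ((\<Sum>i<n. y i * f i xs) - \<Lambda> * kl_div n y q)
          + t * ((\<Sum>i<n. y i * f i x) - \<Lambda> * kl_div n y q)"
        by (simp add: reg_max_def y_def[symmetric] algebra_simps)
      moreover have "(1 - t) * ((\<Sum>i<n. y i * f i xs) - \<Lambda> * kl_div n y q) \<le> (1 - t) * primal xs"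
        using reg_max_ge[OF y, of "vals xs"] t by (intro mult_left_mono) auto
      \<comment> \<open>Minimality of \<open>xs\<close> is applied at \<open>xt\<close>; the share
        \<open>(1 - t) * primal xs\<close> cancels and a factor \<open>t\<close> remains.\<close>
      ultimately have "t * primal xs \<le> t * ((\<Sum>i<n. y i * f i x) - \<Lambda> * kl_div n y q)"
        using min[OF xt] by (simp add: algebra_simps)
      then have *: "primal xs \<le> (\<Sum>i<n. y i * f i x) - \<Lambda> * kl_div n y q"
        using t by simp
      have "(\<Sum>i<n. y i * f i xs) - \<Lambda> * kl_div n y q \<le> (\<Sum>i<n. p i * f i xs) - \<Lambda> * kl_div n p q"
        using reg_max_ge[OF y, of "vals xs"] by (simp add: reg_max_def p_def[symmetric])
      moreover have "(\<Sum>i<n. p i * f i xs) - (\<Sum>i<n. y i * f i xs) \<le> M * (\<Sum>i<n. \<bar>y i - p i\<bar>)"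
        using payoff_diff_le[OF xs, of p y] by (simp add: abs_minus_commute)
      moreover have "(\<Sum>i<n. y i * f i x) - (\<Sum>i<n. p i * f i x) \<le> M * (\<Sum>i<n. \<bar>y i - p i\<bar>)"
        using payoff_diff_le[OF x] .
      \<comment> \<open>Exchanging \<open>y\<close> for \<open>p\<close> costs this once at
        \<open>xs\<close> and once at \<open>x\<close>, whence the factor \<open>4\<close> in the
        perturbation.\<close>
      moreover have "M * (\<Sum>i<n. \<bar>y i - p i\<bar>) \<le> M * (2 * (t * (G * R)) / \<Lambda>)"
      proof (intro mult_left_mono M_nonneg)
        have "l2_dist d xt xs \<le> t * R"
          using l2_dist_segment[of t xs x] X_diameter[OF x xs] t by (simp add: xt_def)
        then have "G * l2_dist d xt xs \<le> t * (G * R)"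
          using mult_left_mono[OF _ G_nonneg] by (fastforce simp: mult.left_commute)
        then have "\<bar>vals xt i - vals xs i\<bar> \<le> t * (G * R)" if "i < n" for i
          using f_diff_le[OF that xt xs] that by simp
        then show "(\<Sum>i<n. \<bar>y i - p i\<bar>) \<le> 2 * (t * (G * R)) / \<Lambda>"
          unfolding y_def p_def by (rule response_l1_lipschitz)
      qed
      ultimately have "primal xs \<le> (\<Sum>i<n. p i * f i x) - \<Lambda> * kl_div n p q
          + 2 * (M * (2 * (t * (G * R)) / \<Lambda>))" using * by linarith
      then show ?thesis by (simp add: mult_ac)
    qed
    from nonneg_if_perturbation_nonneg[OF this] show ?thesis by simp
  qed
  then show thesis using that[OF xs] by (simp add: p_def)
qed

section \<open>Drift of the stochastic subgradient steps\<close>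

abbreviation "step \<eta> \<equiv> (\<lambda>i z. sgd_step n d X G cap \<eta> \<Lambda> q i (oracle i (fst z)) z)"

lemma step_in: "z \<in> X \<times> UNIV \<Longrightarrow> step \<eta> i z \<in> X \<times> UNIV"
  by (simp add: sgd_step_def Let_def nearest_in X_compact X_nonempty X_convex)

text \<open>The descent is joint in \<open>x\<close> and \<open>\<nu>\<close>, so the gap uses the
  lagrangian; by weak duality it dominates \<open>primal (fst z) - u\<close>.\<close>

definition gap :: "real \<Rightarrow> rvec \<times> real \<Rightarrow> real"
  where "gap u z = lagrangian (vals (fst z)) (snd z) - u"

text \<open>The weight \<open>G^2\<close> compensates the different step sizes,
  \<open>\<eta> / G^2\<close> in \<open>x\<close> and \<open>\<eta>\<close> in
  \<open>\<nu>\<close>.\<close>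

definition potential :: "rvec \<Rightarrow> real \<Rightarrow> rvec \<times> real \<Rightarrow> real"
  where "potential xs \<nu>s z = G\<^sup>2 * sq_dist d (fst z) xs + (snd z - \<nu>s)\<^sup>2"

lemma step_point_sq_dist_le:
  assumes z: "fst z \<in> X" and xs: "xs \<in> X" and i: "i < n" and \<eta>: "0 \<le> \<eta>"
    and w: "w = real n * capped_exp cap \<Lambda> (q i) (f i (fst z) - snd z)"
  shows "G\<^sup>2 * sq_dist d (fst (step \<eta> i z)) xs
    \<le> G\<^sup>2 * sq_dist d (fst z) xs - 2 * \<eta> * w * (f i (fst z) - f i xs) + \<eta>\<^sup>2 * w\<^sup>2"
proof -
  define x where "x = fst z"
  define v where "v = g i x"
  define s where "s = \<eta> / G\<^sup>2 * w"
  define ip where "ip = (\<Sum>j<d. v j * (xs j - x j))"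
  have w0: "0 \<le> w"
    unfolding w using capped_exp_pos[OF cap_pos q_pos[OF i]] by (simp add: less_imp_le)
  have sub: "is_subgradient d (f i) x v" using g_subgradient[OF i z] by (simp add: x_def v_def)
  have "ip \<le> f i xs - f i x"
    using sub X_subset[OF xs] by (auto simp: is_subgradient_def ip_def)
  then have ip: "2 * \<eta> * w * ip \<le> 2 * \<eta> * w * (f i xs - f i x)"
    using \<eta> w0 by (intro mult_left_mono) auto
  have v2: "(\<Sum>j<d. (v j)\<^sup>2) \<le> G\<^sup>2"
    using subgradient_norm_le[OF f_lipschitz[OF i] sub] X_subset z by (simp add: x_def)
  have "fst (step \<eta> i z) = nearest d X (\<lambda>j. x j - s * v j)"
    by (simp add: sgd_step_def Let_def first_order_oracle_def w x_def v_def s_def mult_ac)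
  then have "sq_dist d (fst (step \<eta> i z)) xs \<le> sq_dist d (\<lambda>j. x j - s * v j) xs"
    using sq_dist_nearest_le[OF X_compact X_nonempty X_convex xs] by simp
  also have "\<dots> = (\<Sum>j<d. (x j - xs j)\<^sup>2 + (2 * s) * (v j * (xs j - x j)) + s\<^sup>2 * (v j)\<^sup>2)"
    unfolding sq_dist_def by (intro sum.cong) (auto simp: power2_eq_square algebra_simps)
  also have "\<dots> = sq_dist d x xs + 2 * s * ip + s\<^sup>2 * (\<Sum>j<d. (v j)\<^sup>2)"
    by (simp add: sum.distrib sq_dist_def ip_def sum_distrib_left)
  finally have "G\<^sup>2 * sq_dist d (fst (step \<eta> i z)) xs
      \<le> G\<^sup>2 * (sq_dist d x xs + 2 * s * ip + s\<^sup>2 * (\<Sum>j<d. (v j)\<^sup>2))"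
    by (intro mult_left_mono) auto
  also have "\<dots> \<le> G\<^sup>2 * sq_dist d x xs + 2 * \<eta> * w * ip + \<eta>\<^sup>2 * w\<^sup>2"
  \<comment> \<open>For \<open>G = 0\<close> the left side is zero, and on the right
    \<open>ip\<close> vanishes because the subgradient does.\<close>
  proof (cases "G = 0")
    case True
    then have "(\<Sum>j<d. (v j)\<^sup>2) = 0"
      using v2 sum_nonneg[of "{..<d}" "\<lambda>j. (v j)\<^sup>2"] by simp
    then have "\<forall>j<d. v j = 0" by (simp add: sum_nonneg_eq_0_iff)
    then have "ip = 0" by (simp add: ip_def)
    with True show ?thesis by simp
  next
    case False
    then have Gs: "G\<^sup>2 * s = \<eta> * w" by (simp add: s_def)
    have "G\<^sup>2 * (s\<^sup>2 * (\<Sum>j<d. (v j)\<^sup>2)) \<le> G\<^sup>2 * (s\<^sup>2 * G\<^sup>2)"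
      using v2 by (intro mult_left_mono) auto
    also have "\<dots> = (G\<^sup>2 * s)\<^sup>2" by (simp add: power2_eq_square mult_ac)
    also have "\<dots> = \<eta>\<^sup>2 * w\<^sup>2" by (simp only: Gs power_mult_distrib)
    finally have "G\<^sup>2 * (s\<^sup>2 * (\<Sum>j<d. (v j)\<^sup>2)) \<le> \<eta>\<^sup>2 * w\<^sup>2" .
    moreover have "G\<^sup>2 * (2 * s * ip) = 2 * (G\<^sup>2 * s) * ip" by (simp only: mult_ac)
    then have "G\<^sup>2 * (2 * s * ip) = 2 * \<eta> * w * ip" by (simp only: Gs mult.assoc)
    ultimately show ?thesis by (simp only: distrib_left)
  qed
  finally show ?thesis using ip by (simp add: x_def algebra_simps)
qed

text \<open>Combines the subgradient inequalities of \<open>f i\<close> in \<open>x\<close> and of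
  the conjugate in \<open>f i x - \<nu>\<close>. The squared steps total
  \<open>w^2 + (1 - w)^2\<close>; as \<open>n * cap = 1 / \<alpha>\<close>, the bound
  \<open>w \<le> 1 / \<alpha>\<close> makes this linear in \<open>w\<close>.\<close>

lemma step_potential_le:
  assumes z: "fst z \<in> X" and xs: "xs \<in> X" and i: "i < n" and \<eta>: "0 \<le> \<eta>"
  shows "potential xs \<nu>s (step \<eta> i z) \<le> potential xs \<nu>s z
    - 2 * \<eta> * (real n * (capped_conj cap \<Lambda> (q i) (f i (fst z) - snd z)
        - capped_conj cap \<Lambda> (q i) (f i xs - \<nu>s)) + snd z - \<nu>s)
    + \<eta>\<^sup>2 * (1 + 2 / \<alpha> * (real n * capped_exp cap \<Lambda> (q i) (f i (fst z) - snd z)))"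
proof -
  define x where "x = fst z"
  define \<nu> where "\<nu> = snd z"
  define a where "a = capped_exp cap \<Lambda> (q i) (f i x - \<nu>)"
  define w where "w = real n * a"
  define h where "h = capped_conj cap \<Lambda> (q i) (f i x - \<nu>)"
  define hs where "hs = capped_conj cap \<Lambda> (q i) (f i xs - \<nu>s)"
  have a0: "0 \<le> a" unfolding a_def using capped_exp_pos[OF cap_pos q_pos[OF i]] by (simp add: less_imp_le)
  then have w0: "0 \<le> w" by (simp add: w_def)
  have "w \<le> real n * cap" unfolding w_def a_def by (intro mult_left_mono capped_exp_le) auto
  then have w1: "w \<le> 1 / \<alpha>" using n_ge by simp
  then have w2: "w * w \<le> 1 / \<alpha> * w" using w0 by (rule mult_right_mono)
  have "h + a * ((f i xs - \<nu>s) - (f i x - \<nu>)) \<le> hs"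
    unfolding h_def hs_def a_def by (rule capped_conj_subgradient[OF \<Lambda>_pos q_pos[OF i] cap_pos])
  then have "real n * (h - hs) \<le> real n * (a * ((f i x - \<nu>) - (f i xs - \<nu>s)))"
    by (intro mult_left_mono) (auto simp: algebra_simps)
  then have sg: "2 * \<eta> * (real n * (h - hs)) \<le> 2 * \<eta> * (w * ((f i x - \<nu>) - (f i xs - \<nu>s)))"
    using \<eta> by (intro mult_left_mono) (auto simp: w_def)
  have "snd (step \<eta> i z) = \<nu> - \<eta> * (1 - w)"
    by (simp add: sgd_step_def Let_def first_order_oracle_def w_def a_def x_def \<nu>_def)
  then have "(snd (step \<eta> i z) - \<nu>s)\<^sup>2 = ((\<nu> - \<eta> * (1 - w)) - \<nu>s)\<^sup>2" by (simp only:)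
  also have "\<dots> = (\<nu> - \<nu>s)\<^sup>2 - 2 * \<eta> * (1 - w) * (\<nu> - \<nu>s) + \<eta>\<^sup>2 * (1 - w)\<^sup>2"
    by (simp add: power2_eq_square algebra_simps)
  finally have "(snd (step \<eta> i z) - \<nu>s)\<^sup>2 =
      (\<nu> - \<nu>s)\<^sup>2 - 2 * \<eta> * (1 - w) * (\<nu> - \<nu>s) + \<eta>\<^sup>2 * (1 - w)\<^sup>2" .
  moreover have "\<eta>\<^sup>2 * (w\<^sup>2 + (1 - w)\<^sup>2) \<le> \<eta>\<^sup>2 * (1 + 2 / \<alpha> * w)"
  proof (intro mult_left_mono)
    have "w\<^sup>2 + (1 - w)\<^sup>2 = 1 + 2 * (w * w) - 2 * w" by (simp add: power2_eq_square algebra_simps)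
    moreover have "2 / \<alpha> * w = 2 * (1 / \<alpha> * w)" by simp
    ultimately show "w\<^sup>2 + (1 - w)\<^sup>2 \<le> 1 + 2 / \<alpha> * w" using w0 w2 by linarith
  qed simp
  ultimately show ?thesis
    using step_point_sq_dist_le[OF z xs i \<eta> refl] sg
    unfolding potential_def x_def[symmetric] \<nu>_def[symmetric] a_def[symmetric] w_def[symmetric]
      h_def[symmetric] hs_def[symmetric]
    by (simp add: algebra_simps)
qed

text \<open>Averaging over \<open>i\<close> turns the weights into the mass, which is at most linear
  in the gap. The condition \<open>6 * \<eta> \<le> \<alpha> * \<Lambda>\<close> lets half of the
  descent \<open>2 * \<eta> * gap\<close> absorb the part of the variance that grows with the
  gap.\<close>

lemma potential_drift:
  assumes z: "z \<in> X \<times> UNIV" and xs: "xs \<in> X" and root: "mass (vals xs) \<nu>s = 1"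
    and min: "\<And>x. x \<in> X \<Longrightarrow> primal xs \<le> primal x" and \<eta>: "0 \<le> \<eta>" "6 * \<eta> \<le> \<alpha> * \<Lambda>"
  shows "(\<Sum>i<n. potential xs \<nu>s (step \<eta> i z)) / real n
    \<le> potential xs \<nu>s z - \<eta> * gap (primal xs) z + 7 * \<eta>\<^sup>2 / \<alpha>"
proof -
  define \<nu> where "\<nu> = snd z"
  define S where "S = mass (vals (fst z)) \<nu>"
  define \<gamma> where "\<gamma> = gap (primal xs) z"
  have x: "fst z \<in> X" using z by auto
  have n0: "real n \<noteq> 0" using n_ge by simp
  have "(\<Sum>i<n. potential xs \<nu>s (step \<eta> i z)) / real n
      \<le> (\<Sum>i<n. potential xs \<nu>s z
        - 2 * \<eta> * (real n * (capped_conj cap \<Lambda> (q i) (f i (fst z) - \<nu>)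
            - capped_conj cap \<Lambda> (q i) (f i xs - \<nu>s)) + \<nu> - \<nu>s)
        + \<eta>\<^sup>2 * (1 + 2 / \<alpha> * (real n * capped_exp cap \<Lambda> (q i) (f i (fst z) - \<nu>)))) / real n"
    unfolding \<nu>_def using step_potential_le[OF x xs _ \<eta>(1)] by (intro divide_right_mono sum_mono) auto
  also have "\<dots> = potential xs \<nu>s z
      - 2 * \<eta> * (lagrangian (vals (fst z)) \<nu> - lagrangian (vals xs) \<nu>s) + \<eta>\<^sup>2 * (1 + 2 / \<alpha> * S)"
    using n0 by (simp add: S_def sum.distrib sum_subtractf sum_distrib_left[symmetric]
        sum_divide_distrib[symmetric] add_divide_distrib diff_divide_distrib)
      (simp add: field_simps sum_distrib_left sum_divide_distrib)
  also have "\<dots> \<le> potential xs \<nu>s z - 2 * \<eta> * \<gamma> + \<eta>\<^sup>2 * (1 + 2 / \<alpha> * S)"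
  proof -
    have "\<gamma> \<le> lagrangian (vals (fst z)) \<nu> - lagrangian (vals xs) \<nu>s"
      using lagrangian_le_reg_max[OF root] by (simp add: \<gamma>_def gap_def \<nu>_def)
    then have "2 * \<eta> * \<gamma> \<le> 2 * \<eta> * (lagrangian (vals (fst z)) \<nu> - lagrangian (vals xs) \<nu>s)"
      using \<eta> by (intro mult_left_mono) auto
    then show ?thesis by linarith
  qed
  also have "\<eta>\<^sup>2 * (1 + 2 / \<alpha> * S) \<le> 7 * \<eta>\<^sup>2 / \<alpha> + \<eta> * \<gamma>"
  proof -
    have "primal xs \<le> lagrangian (vals (fst z)) \<nu>"
      using min[OF x] reg_max_le_lagrangian[of "vals (fst z)" \<nu>] by linarith
    then have \<gamma>0: "0 \<le> \<gamma>" by (simp add: \<gamma>_def gap_def \<nu>_def)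
    have "S \<le> 3 * (1 + \<gamma> / \<Lambda>)"
      unfolding S_def \<gamma>_def gap_def \<nu>_def by (rule mass_le_lagrangian_gap[OF min[OF x]])
    then have "2 / \<alpha> * S \<le> 2 / \<alpha> * (3 * (1 + \<gamma> / \<Lambda>))" using \<alpha>_pos by (intro mult_left_mono) auto
    \<comment> \<open>The \<open>7\<close> consists of \<open>6\<close> from the mass bound and this
      \<open>1\<close>, enlarged to \<open>1 / \<alpha>\<close>.\<close>
    moreover have "1 \<le> 1 / \<alpha>" using \<alpha>_pos \<alpha>_le by simp
    moreover have "2 / \<alpha> * (3 * (1 + \<gamma> / \<Lambda>)) = 6 * (1 / \<alpha>) + 6 * \<gamma> / (\<alpha> * \<Lambda>)"
      by (simp add: distrib_left)
    moreover have "7 / \<alpha> = 7 * (1 / \<alpha>)" by simp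
    ultimately have "1 + 2 / \<alpha> * S \<le> 7 / \<alpha> + 6 * \<gamma> / (\<alpha> * \<Lambda>)" by linarith
    then have "\<eta>\<^sup>2 * (1 + 2 / \<alpha> * S) \<le> \<eta>\<^sup>2 * (7 / \<alpha> + 6 * \<gamma> / (\<alpha> * \<Lambda>))"
      by (intro mult_left_mono) auto
    also have "\<dots> = 7 * \<eta>\<^sup>2 / \<alpha> + \<eta> * \<gamma> * (6 * \<eta> / (\<alpha> * \<Lambda>))"
      by (simp add: power2_eq_square algebra_simps)
    also have "\<eta> * \<gamma> * (6 * \<eta> / (\<alpha> * \<Lambda>)) \<le> \<eta> * \<gamma> * 1"
      using \<eta> \<gamma>0 \<alpha>_pos \<Lambda>_pos by (intro mult_left_mono) auto
    finally show ?thesis by simp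
  qed
  finally show ?thesis by (simp add: \<gamma>_def)
qed

text \<open>The step size makes the noise \<open>7 * \<eta>^2 / \<alpha>\<close> equal to
  \<open>\<eta> * \<delta> / 2\<close>, and the bound on \<open>T\<close> keeps the initial
  potential, spread over \<open>T\<close> steps, below the same amount. The step condition of
  \<open>potential_drift\<close> follows from \<open>\<delta> \<le> \<Lambda>\<close>.\<close>

lemma mean_gap_le:
  assumes x0: "x0 \<in> X" and xs: "xs \<in> X" and min: "\<And>x. x \<in> X \<Longrightarrow> primal xs \<le> primal x"
    and \<delta>: "0 < \<delta>" "\<delta> \<le> \<Lambda>" and T: "1 \<le> T" "56 * G\<^sup>2 * R\<^sup>2 / (\<alpha> * \<delta>\<^sup>2) \<le> real T"
    and \<eta>: "\<eta> = \<alpha> * \<delta> / 14"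
  shows "(\<Sum>t<T. walk_mean n (step \<eta>) t (gap (primal xs)) (x0, multiplier n cap \<Lambda> q (vals x0))) / real T
    \<le> \<delta>"
proof -
  define \<nu>0 where "\<nu>0 = multiplier n cap \<Lambda> q (vals x0)"
  define A where "A = (\<Sum>t<T. walk_mean n (step \<eta>) t (gap (primal xs)) (x0, \<nu>0))"
  have "\<bar>vals xs i - vals x0 i\<bar> \<le> G * R" if "i < n" for i
    using f_diff_le_diameter[OF that xs x0] that by simp
  moreover have "0 \<le> G * R" using G_nonneg R_nonneg by simp
  moreover have "mass (vals x0) \<nu>0 = 1" unfolding \<nu>0_def by (rule mass_multiplier)
  \<comment> \<open>A root at the unknown minimizer lies within \<open>G * R\<close> of the computed
    one, so each half of the initial potential is at most \<open>G^2 * R^2\<close>.\<close>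
  ultimately obtain \<nu>s where \<nu>s: "\<bar>\<nu>s - \<nu>0\<bar> \<le> G * R" "mass (vals xs) \<nu>s = 1"
    using mass_root_near[of "vals xs" "vals x0" "G * R" \<nu>0] by blast
  have \<eta>0: "0 < \<eta>" using \<alpha>_pos \<delta> by (simp add: \<eta>)
  have "\<alpha> * \<delta> \<le> \<alpha> * \<Lambda>" using \<alpha>_pos \<delta> by simp
  then have \<eta>6: "6 * \<eta> \<le> \<alpha> * \<Lambda>" unfolding \<eta> using \<alpha>_pos \<delta> by simp
  have "(\<Sum>t<T. walk_mean n (step \<eta>) t (\<lambda>z. \<eta> * gap (primal xs) z) (x0, \<nu>0))
      \<le> potential xs \<nu>s (x0, \<nu>0) + real T * (7 * \<eta>\<^sup>2 / \<alpha>)"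
  proof (rule walk_mean_sum_le_potential[where S = "X \<times> UNIV" and s = "step \<eta>", OF n_ge step_in])
    show "0 \<le> potential xs \<nu>s z" for z
      by (simp add: potential_def sq_dist_def sum_nonneg)
    show "(\<Sum>i<n. potential xs \<nu>s (step \<eta> i z)) / real n
        \<le> potential xs \<nu>s z - \<eta> * gap (primal xs) z + 7 * \<eta>\<^sup>2 / \<alpha>" if "z \<in> X \<times> UNIV" for z
      using potential_drift[OF that xs \<nu>s(2) min _ \<eta>6] \<eta>0 by simp
  qed (use x0 in auto)
  moreover have "potential xs \<nu>s (x0, \<nu>0) \<le> 2 * (G\<^sup>2 * R\<^sup>2)"
  proof -
    have "sq_dist d x0 xs \<le> R\<^sup>2"
      unfolding l2_dist_sq[symmetric] using X_diameter[OF x0 xs] l2_dist_nonneg by (intro power_mono)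
    then have "G\<^sup>2 * sq_dist d x0 xs \<le> G\<^sup>2 * R\<^sup>2" by (intro mult_left_mono) auto
    moreover have "\<bar>\<nu>0 - \<nu>s\<bar>\<^sup>2 \<le> (G * R)\<^sup>2"
      using \<nu>s(1) by (intro power_mono) (auto simp: abs_minus_commute)
    ultimately show ?thesis by (simp add: potential_def power_mult_distrib)
  qed
  moreover have "(\<Sum>t<T. walk_mean n (step \<eta>) t (\<lambda>z. \<eta> * gap (primal xs) z) (x0, \<nu>0)) = \<eta> * A"
    unfolding A_def sum_distrib_left
    using walk_mean_affine[OF n_ge, where a = 0 and b = \<eta>] by (intro sum.cong) auto
  ultimately have "\<eta> * A \<le> 2 * (G\<^sup>2 * R\<^sup>2) + real T * (7 * \<eta>\<^sup>2 / \<alpha>)" by linarith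
  also have "2 * (G\<^sup>2 * R\<^sup>2) \<le> real T * (\<alpha> * \<delta>\<^sup>2 / 28)"
    using T(2) \<alpha>_pos \<delta>(1) by (simp add: field_simps)
  also have "real T * (\<alpha> * \<delta>\<^sup>2 / 28) + real T * (7 * \<eta>\<^sup>2 / \<alpha>) = \<eta> * (real T * \<delta>)"
    using \<alpha>_pos by (simp add: \<eta> power2_eq_square field_simps)
  finally have "A \<le> real T * \<delta>" using \<eta>0 by simp
  then show ?thesis
    using T(1) by (simp add: A_def[symmetric] \<nu>0_def[symmetric] field_simps)
qed

end

section \<open>Queries and accuracy of the chained phases\<close>

context cvar_problem
begin

lemma query_all_vals:
  "(\<lambda>i. if i \<in> set [0..<n] then f i x else 0) = vals x"
  by (auto simp: vals_def)

lemma expected_output_query_all: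
  "expected_output oracle h (query_all [0..<n] x (\<lambda>_. 0) k) = expected_output oracle h (k (vals x))"
  unfolding query_all_correct query_all_vals ..

lemma query_bound_query_all_vals:
  assumes "x \<in> X" "query_bound oracle ({..<n} \<times> X) Y N (k (vals x))"
  shows "query_bound oracle ({..<n} \<times> X) Y (n + N) (query_all [0..<n] x (\<lambda>_. 0) k)"
proof -
  have "set [0..<n] \<times> {x} \<subseteq> {..<n} \<times> X" using assms(1) by auto
  from query_bound_query_all[OF this, where f = f and g = g and k = k and v = "\<lambda>_. 0"]
  show ?thesis using assms(2) unfolding query_all_vals by simp
qed

lemma query_bound_phases:
  assumes x0: "x0 \<in> X" and T: "1 \<le> T" and \<Lambda>: "0 < \<Lambda>" and q: "q \<in> pos_capped_simplex n cap"
  shows "query_bound oracle ({..<n} \<times> X) (capped_simplex n cap) (K * (T + n))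
    (phases n d X G cap \<eta> T x0 v0 K \<Lambda> q)"
  using \<Lambda> q
proof (induction K arbitrary: \<Lambda> q)
  case 0
  then show ?case by (auto simp: pos_capped_simplex_def intro!: query_bound_Output)
next
  case (Suc K)
  interpret cvar_phase n d X R G M \<alpha> f g \<Lambda> q
    by unfold_locales (use Suc.prems cap_pos in auto)
  have "query_bound oracle ({..<n} \<times> X) (capped_simplex n cap) (n + K * (T + n))
      (query_all [0..<n] x (\<lambda>_. 0) (\<lambda>v. phases n d X G cap \<eta> T x0 v0 K (2 * \<Lambda>) (response n cap \<Lambda> q v)))"
    if "x \<in> X" for x
    using that \<Lambda>_pos by (intro query_bound_query_all_vals Suc.IH response_in) auto
  then have "query_bound oracle ({..<n} \<times> X) (capped_simplex n cap) (\<tau> + (n + K * (T + n)))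
      (sgd_loop n (sgd_step n d X G cap \<eta> \<Lambda> q) \<tau> (x0, multiplier n cap \<Lambda> q v0)
        (\<lambda>z. query_all [0..<n] (fst z) (\<lambda>_. 0)
          (\<lambda>v. phases n d X G cap \<eta> T x0 v0 K (2 * \<Lambda>) (response n cap \<Lambda> q v))))" for \<tau>
    using step_in x0 n_ge by (intro query_bound_sgd_loop[where S = "X \<times> UNIV"]) auto
  note loop = this
  show ?case
    unfolding phases.simps
  proof (rule query_bound_uniform_choice[OF T])
    show "query_bound oracle ({..<n} \<times> X) (capped_simplex n cap) (Suc K * (T + n))
        (sgd_loop n (sgd_step n d X G cap \<eta> \<Lambda> q) \<tau> (x0, multiplier n cap \<Lambda> q v0)
          (\<lambda>z. query_all [0..<n] (fst z) (\<lambda>_. 0)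
            (\<lambda>v. phases n d X G cap \<eta> T x0 v0 K (2 * \<Lambda>) (response n cap \<Lambda> q v))))"
      if "\<tau> < T" for \<tau>
      by (rule query_bound_mono[OF loop]) (use that in simp)
  qed
qed

text \<open>The induction changes the comparator: \<open>p\<close> gives way to the dual solution
  \<open>resp xs\<close> of the phase. The next phase charges \<open>2 * \<Lambda>\<close> times the
  divergence from \<open>resp xs\<close> to the new reference, which is at most twice the gap and
  hence \<open>2 * \<delta>\<close> in expectation.\<close>

lemma expected_output_phases_ge:
  assumes x0: "x0 \<in> X" and \<delta>: "0 < \<delta>" and T: "1 \<le> T" "56 * G\<^sup>2 * R\<^sup>2 / (\<alpha> * \<delta>\<^sup>2) \<le> real T"
    and \<eta>: "\<eta> = \<alpha> * \<delta> / 14"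
    and \<Lambda>: "\<delta> \<le> \<Lambda>" and q: "q \<in> pos_capped_simplex n cap" and p: "p \<in> capped_simplex n cap"
  shows "\<phi> p - \<Lambda> * kl_div n p q - 2 * real K * \<delta> - M\<^sup>2 / (2 ^ K * \<Lambda>)
    \<le> expected_output oracle \<phi> (phases n d X G cap \<eta> T x0 (vals x0) K \<Lambda> q)"
  using \<Lambda> q p
proof (induction K arbitrary: \<Lambda> q p)
  case 0
  then show ?case using dual_objective_diff_le[of p q \<Lambda>] \<delta> by simp
next
  case (Suc K)
  have \<Lambda>0: "0 < \<Lambda>" using Suc.prems \<delta> by linarith
  interpret cvar_phase n d X R G M \<alpha> f g \<Lambda> q
    by unfold_locales (use Suc.prems cap_pos \<Lambda>0 in auto)
  let ?next = "\<lambda>v. phases n d X G cap \<eta> T x0 (vals x0) K (2 * \<Lambda>) (response n cap \<Lambda> q v)"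
  let ?k = "\<lambda>z. query_all [0..<n] (fst z) (\<lambda>_. 0) ?next"
  let ?z0 = "(x0, multiplier n cap \<Lambda> q (vals x0))"
  obtain xs where xs: "xs \<in> X"
    and saddle: "\<And>x. x \<in> X \<Longrightarrow> primal xs \<le> (\<Sum>i<n. resp xs i * f i x) - \<Lambda> * kl_div n (resp xs) q"
    using regularized_saddle_point by blast
  \<comment> \<open>What the remaining \<open>K\<close> phases guarantee against
    \<open>resp xs\<close> before that charge; the doubled \<open>\<Lambda>\<close> accounts for the
    exponent \<open>Suc K\<close>.\<close>
  define b where "b = \<phi> (resp xs) - 2 * real K * \<delta> - M\<^sup>2 / (2 ^ Suc K * \<Lambda>)"
  have min: "primal xs \<le> primal x" if "x \<in> X" for x
    using saddle[OF that] reg_max_ge[OF resp_in, of xs "vals x"] by simp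
  have tail: "b - 2 * gap (primal xs) z \<le> expected_output oracle \<phi> (?k z)"
    if z: "z \<in> X \<times> UNIV" for z
  proof -
    have x: "fst z \<in> X" using z by auto
    have "\<Lambda> * kl_div n (resp xs) (resp (fst z)) \<le> primal (fst z) - primal xs"
      using reg_max_three_point[OF resp_in, of xs "vals (fst z)"] saddle[OF x] by simp
    also have "\<dots> \<le> gap (primal xs) z"
      using reg_max_le_lagrangian[of "vals (fst z)" "snd z"] by (simp add: gap_def)
    finally have "b - 2 * gap (primal xs) z \<le> \<phi> (resp xs) - 2 * \<Lambda> * kl_div n (resp xs) (resp (fst z))
        - 2 * real K * \<delta> - M\<^sup>2 / (2 ^ K * (2 * \<Lambda>))"
      by (simp add: b_def mult_ac)
    also have "\<dots> \<le> expected_output oracle \<phi> (?next (vals (fst z)))"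
      using Suc.IH[of "2 * \<Lambda>" "resp (fst z)" "resp xs"] Suc.prems \<Lambda>_pos response_in resp_in by simp
    finally show ?thesis unfolding expected_output_query_all .
  qed
  have bound: "query_bound oracle ({..<n} \<times> X) (capped_simplex n cap) (n + K * (T + n)) (?k z)"
    if "z \<in> X \<times> UNIV" for z
    using that \<Lambda>_pos by (intro query_bound_query_all_vals query_bound_phases x0 T(1) response_in) auto
  have "expected_output oracle \<phi> (phases n d X G cap \<eta> T x0 (vals x0) (Suc K) \<Lambda> q)
      = (\<Sum>\<tau><T. expected_output oracle \<phi> (sgd_loop n (sgd_step n d X G cap \<eta> \<Lambda> q) \<tau> ?z0 ?k)) / real T"
    unfolding phases.simps
  proof (rule expected_output_uniform_choice[OF T(1)])
    fix \<tau> assume \<tau>: "\<tau> < T"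
    have "query_bound oracle ({..<n} \<times> X) (capped_simplex n cap) (\<tau> + (n + K * (T + n)))
        (sgd_loop n (sgd_step n d X G cap \<eta> \<Lambda> q) \<tau> ?z0 ?k)"
      using step_in x0 n_ge bound by (intro query_bound_sgd_loop[where S = "X \<times> UNIV"]) auto
    then show "query_bound oracle ({..<n} \<times> X) (capped_simplex n cap) (T + (n + K * (T + n)))
        (sgd_loop n (sgd_step n d X G cap \<eta> \<Lambda> q) \<tau> ?z0 ?k)"
      by (rule query_bound_mono) (use \<tau> in simp)
  qed
  also have "\<dots> = (\<Sum>\<tau><T. walk_mean n (step \<eta>) \<tau> (\<lambda>z. expected_output oracle \<phi> (?k z)) ?z0) / real T"
    using step_in x0 n_ge bound
    by (intro arg_cong2[where f = "(/)"] sum.cong refl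
        expected_output_sgd_loop[where S = "X \<times> UNIV" and Q = "{..<n} \<times> X"]) auto
  also have "\<dots> \<ge> (\<Sum>\<tau><T. walk_mean n (step \<eta>) \<tau> (\<lambda>z. b + (- 2) * gap (primal xs) z) ?z0) / real T"
    using step_in x0 tail
    by (intro divide_right_mono sum_mono walk_mean_mono[where S = "X \<times> UNIV"]) auto
  also have "(\<Sum>\<tau><T. walk_mean n (step \<eta>) \<tau> (\<lambda>z. b + (- 2) * gap (primal xs) z) ?z0) / real T
      = b - 2 * ((\<Sum>\<tau><T. walk_mean n (step \<eta>) \<tau> (gap (primal xs)) ?z0) / real T)"
    unfolding walk_mean_affine[OF n_ge] sum.distrib sum_distrib_left[symmetric] add_divide_distrib
    using T(1) by simp
  finally have "b - 2 * ((\<Sum>\<tau><T. walk_mean n (step \<eta>) \<tau> (gap (primal xs)) ?z0) / real T)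
      \<le> expected_output oracle \<phi> (phases n d X G cap \<eta> T x0 (vals x0) (Suc K) \<Lambda> q)" .
  moreover have "(\<Sum>\<tau><T. walk_mean n (step \<eta>) \<tau> (gap (primal xs)) ?z0) / real T \<le> \<delta>"
    using Suc.prems by (intro mean_gap_le x0 xs min \<delta> T \<eta>) auto
  \<comment> \<open>As a competitor at \<open>xs\<close>, \<open>p\<close> gives at most
    \<open>primal xs\<close>; the saddle property carries this to every \<open>x\<close> for the
    weights \<open>resp xs\<close>.\<close>
  moreover have "\<phi> p - \<Lambda> * kl_div n p q \<le> \<phi> (resp xs)"
  proof -
    have "\<phi> p - \<Lambda> * kl_div n p q \<le> primal xs"
      using dual_objective_le[OF Suc.prems(3) xs] reg_max_ge[OF Suc.prems(3), of "vals xs"] by simp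
    moreover have "0 \<le> \<Lambda> * kl_div n (resp xs) q"
      using kl_div_nonneg[OF resp_in q_in] \<Lambda>_pos by simp
    ultimately show ?thesis
      using saddle by (intro dual_objective_ge) (smt (verit))
  qed
  ultimately show ?case by (simp add: b_def algebra_simps)
qed

end

section \<open>Choice of the parameters\<close>

definition log_factor :: "nat \<Rightarrow> nat \<Rightarrow> real \<Rightarrow> real \<Rightarrow> real \<Rightarrow> real \<Rightarrow> real"
  where "log_factor n d R G M \<epsilon> = ln (2 + real n + real d + R + G + M + 1 / \<epsilon>)"

text \<open>Three errors of at most \<open>\<epsilon> / 3\<close> are balanced: the initial
  \<open>\<Lambda> = \<epsilon> / (3 * L)\<close> times \<open>ln n\<close>, the loss
  \<open>2 * K * \<delta>\<close> over all phases, and the final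
  \<open>M^2 / (2 ^ K * \<Lambda>)\<close>, for which \<open>K\<close> of order \<open>L\<close>
  suffices. \<open>T\<close> meets the demand of \<open>mean_gap_le\<close>.\<close>

definition dual_cvar_alg ::
    "nat \<Rightarrow> nat \<Rightarrow> rvec set \<Rightarrow> real \<Rightarrow> real \<Rightarrow> real \<Rightarrow> real \<Rightarrow> real \<Rightarrow> query_alg"
  where "dual_cvar_alg n d X R G M \<alpha> \<epsilon> =
    (let L = log_factor n d R G M \<epsilon>;
         K = nat \<lceil>16 * L\<rceil>;
         \<delta> = \<epsilon> / (6 * real K * L);
         T = nat \<lceil>56 * G\<^sup>2 * R\<^sup>2 / (\<alpha> * \<delta>\<^sup>2)\<rceil> + 1;
         x0 = (SOME x. x \<in> X)
     in query_all [0..<n] x0 (\<lambda>_. 0) (\<lambda>v.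
          phases n d X G (1 / (\<alpha> * real n)) (\<alpha> * \<delta> / 14) T x0 v K (\<epsilon> / (3 * L))
            (\<lambda>i. if i < n then 1 / real n else 0)))"

context cvar_problem
begin

lemma uniform_in: "(\<lambda>i. if i < n then 1 / real n else 0) \<in> pos_capped_simplex n cap"
proof -
  have "1 / real n \<le> cap"
    using n_ge \<alpha>_pos \<alpha>_le by (intro divide_left_mono) (auto simp: mult_le_cancel_right1)
  then show ?thesis
    using n_ge by (simp add: pos_capped_simplex_def capped_simplex_def)
qed

lemma dual_cvar_alg_correct:
  assumes \<epsilon>: "0 < \<epsilon>" and M: "0 < M"
  defines "A \<equiv> dual_cvar_alg n d X R G M \<alpha> \<epsilon>"
  shows "p \<in> capped_simplex n cap \<Longrightarrow> \<phi> p \<le> expected_output oracle \<phi> A + \<epsilon>"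
    and "\<exists>N. query_bound oracle ({..<n} \<times> X) (capped_simplex n cap) N A \<and>
      real N \<le> 10 ^ 7 * (real n + G\<^sup>2 * R\<^sup>2 / (\<alpha> * \<epsilon>\<^sup>2)) * log_factor n d R G M \<epsilon> ^ 5"
proof -
  define Z where "Z = 2 + real n + real d + R + G + M + 1 / \<epsilon>"
  define L where "L = log_factor n d R G M \<epsilon>"
  define K where "K = nat \<lceil>16 * L\<rceil>"
  define \<delta> where "\<delta> = \<epsilon> / (6 * real K * L)"
  define T where "T = nat \<lceil>56 * G\<^sup>2 * R\<^sup>2 / (\<alpha> * \<delta>\<^sup>2)\<rceil> + 1"
  define x0 where "x0 = (SOME x. x \<in> X)"
  define q where "q = (\<lambda>i. if i < n then 1 / real n else 0)"
  define B where "B = G\<^sup>2 * R\<^sup>2 / (\<alpha> * \<epsilon>\<^sup>2)"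
  have A: "A = query_all [0..<n] x0 (\<lambda>_. 0) (\<lambda>v.
      phases n d X G cap (\<alpha> * \<delta> / 14) T x0 v K (\<epsilon> / (3 * L)) q)"
    by (simp add: A_def dual_cvar_alg_def Let_def L_def K_def \<delta>_def T_def x0_def q_def)
  have x0: "x0 \<in> X" using X_nonempty unfolding x0_def by (rule some_in_eq[THEN iffD2])
  have q: "q \<in> pos_capped_simplex n cap" unfolding q_def by (rule uniform_in)
  have Z: "3 \<le> Z" "real n \<le> Z" "M \<le> Z" "1 / \<epsilon> \<le> Z"
  proof -
    have "1 \<le> real n" "0 \<le> real d" "0 \<le> 1 / \<epsilon>" using n_ge \<epsilon> by auto
    then show "3 \<le> Z" "real n \<le> Z" "M \<le> Z" "1 / \<epsilon> \<le> Z"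
      unfolding Z_def using R_nonneg G_nonneg M_nonneg by linarith+
  qed
  have LZ: "L = ln Z" by (simp add: L_def Z_def log_factor_def)
  then have expL: "exp L = Z" using Z by simp
  have L1: "1 \<le> L" unfolding LZ using Z exp_le by (subst ln_ge_iff) auto
  have K: "16 * L \<le> real K" "real K \<le> 17 * L"
    using L1 by (auto simp: K_def) linarith
  have K1: "1 \<le> real K" using K L1 by linarith
  have "1 * 1 \<le> real K * L" using K1 L1 by (intro mult_mono) auto
  then have KL: "1 \<le> real K * L" by simp
  have \<delta>0: "0 < \<delta>" using \<epsilon> K1 L1 by (simp add: \<delta>_def)
  have "3 * L \<le> 6 * real K * L" using K1 L1 by (intro mult_right_mono) auto
  then have \<delta>\<Lambda>: "\<delta> \<le> \<epsilon> / (3 * L)" unfolding \<delta>_def using \<epsilon> L1 K1 by (intro divide_left_mono) auto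
  have T: "1 \<le> T" "56 * G\<^sup>2 * R\<^sup>2 / (\<alpha> * \<delta>\<^sup>2) \<le> real T"
    "real T \<le> 56 * G\<^sup>2 * R\<^sup>2 / (\<alpha> * \<delta>\<^sup>2) + 2"
  proof -
    have "0 \<le> 56 * G\<^sup>2 * R\<^sup>2 / (\<alpha> * \<delta>\<^sup>2)" using \<alpha>_pos by simp
    then show "1 \<le> T" "56 * G\<^sup>2 * R\<^sup>2 / (\<alpha> * \<delta>\<^sup>2) \<le> real T"
      "real T \<le> 56 * G\<^sup>2 * R\<^sup>2 / (\<alpha> * \<delta>\<^sup>2) + 2"
      unfolding T_def by linarith+
  qed
  \<comment> \<open>Rearranged from \<open>M^2 / (2 ^ K * \<Lambda>) \<le> \<epsilon> / 3\<close> at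
    the initial \<open>\<Lambda>\<close>. The factors are bounded by powers of
    \<open>Z = exp L\<close>, and \<open>ln 2 \<ge> 1 / 2\<close> turns \<open>16 * L\<close>
    doublings into \<open>Z ^ 8\<close>.\<close>
  have pow: "9 * M\<^sup>2 * L / \<epsilon>\<^sup>2 \<le> 2 ^ K"
  proof -
    have "L \<le> Z" unfolding LZ using Z ln_le_minus_one[of Z] by linarith
    have "9 * M\<^sup>2 * L / \<epsilon>\<^sup>2 = 3\<^sup>2 * M\<^sup>2 * L * (1 / \<epsilon>)\<^sup>2" by (simp add: power_divide)
    also have "\<dots> \<le> Z\<^sup>2 * Z\<^sup>2 * Z * Z\<^sup>2"
      using Z \<open>L \<le> Z\<close> L1 M_nonneg \<epsilon> by (intro mult_mono power_mono) auto
    also have "\<dots> = Z ^ 7" by (simp add: power_numeral_reduce)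
    also have "\<dots> \<le> Z ^ 8" using Z by (intro power_increasing) auto
    also have "\<dots> = exp (8 * L)" unfolding expL[symmetric] by (simp add: exp_of_nat_mult[symmetric])
    also have "\<dots> \<le> exp (real K * ln 2)"
    proof -
      have "16 * L * (1 / 2) \<le> real K * ln 2"
        using K L1 ln2_ge_two_thirds by (intro mult_mono) auto
      then show ?thesis by simp
    qed
    also have "\<dots> = 2 ^ K" by (simp add: exp_of_nat_mult)
    finally show ?thesis .
  qed
  show "\<phi> p \<le> expected_output oracle \<phi> A + \<epsilon>" if p: "p \<in> capped_simplex n cap"
  proof -
    have "\<phi> p - \<epsilon> / (3 * L) * kl_div n p q - 2 * real K * \<delta> - M\<^sup>2 / (2 ^ K * (\<epsilon> / (3 * L)))
        \<le> expected_output oracle \<phi> A"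
      unfolding A expected_output_query_all
      by (rule expected_output_phases_ge[OF x0 \<delta>0 T(1,2) refl \<delta>\<Lambda> q p])
    moreover have "\<epsilon> / (3 * L) * kl_div n p q \<le> \<epsilon> / 3"
    proof -
      have "kl_div n p q \<le> ln (real n)" unfolding q_def by (rule kl_div_uniform_le[OF p n_ge])
      also have "\<dots> \<le> L" unfolding LZ using n_ge Z by simp
      finally have "\<epsilon> / (3 * L) * kl_div n p q \<le> \<epsilon> / (3 * L) * L"
        using \<epsilon> L1 by (intro mult_left_mono) auto
      then show ?thesis using L1 by simp
    qed
    moreover have "2 * real K * \<delta> \<le> \<epsilon> / 3"
    proof -
      have "2 * real K * \<delta> = \<epsilon> / 3 / L" using K1 by (simp add: \<delta>_def field_simps)
      also have "\<dots> \<le> \<epsilon> / 3 / 1" using L1 \<epsilon> by (intro divide_left_mono) auto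
      finally show ?thesis by simp
    qed
    moreover have "M\<^sup>2 / (2 ^ K * (\<epsilon> / (3 * L))) \<le> \<epsilon> / 3"
      using pow \<epsilon> L1 by (simp add: field_simps power2_eq_square)
    ultimately show ?thesis by linarith
  qed
  show "\<exists>N. query_bound oracle ({..<n} \<times> X) (capped_simplex n cap) N A \<and>
      real N \<le> 10 ^ 7 * (real n + G\<^sup>2 * R\<^sup>2 / (\<alpha> * \<epsilon>\<^sup>2)) * log_factor n d R G M \<epsilon> ^ 5"
  proof (intro exI conjI)
    show "query_bound oracle ({..<n} \<times> X) (capped_simplex n cap) (n + K * (T + n)) A"
      unfolding A using \<epsilon> L1 by (intro query_bound_query_all_vals query_bound_phases x0 T(1) q) auto
    have B0: "0 \<le> B" using \<alpha>_pos by (simp add: B_def)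
    \<comment> \<open>Inserting \<open>\<delta>\<close> gives \<open>2016 = 56 * 6^2\<close>. Then
      \<open>K\<close> phases of \<open>T\<close> steps cost order \<open>K^3 * L^2 * B\<close>, and
      \<open>K \<le> 17 * L\<close> yields the exponent five.\<close>
    have "56 * G\<^sup>2 * R\<^sup>2 / (\<alpha> * \<delta>\<^sup>2) = 2016 * (real K)\<^sup>2 * L\<^sup>2 * B"
      using \<epsilon> K1 L1 \<alpha>_pos by (simp add: \<delta>_def B_def field_simps power2_eq_square)
    then have T': "real T \<le> 2016 * (real K)\<^sup>2 * L\<^sup>2 * B + 2" using T(3) by simp
    have L5: "L \<le> L ^ 5" "1 \<le> L ^ 5" using L1 by (auto simp: self_le_power)
    have "real (n + K * (T + n)) = real n + real K * real T + real K * real n"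
      by (simp add: algebra_simps)
    also have "\<dots> \<le> real n + real K * (2016 * (real K)\<^sup>2 * L\<^sup>2 * B + 2) + real K * real n"
      using T' by (intro add_mono mult_left_mono) auto
    also have "\<dots> = real n + 2016 * ((real K) ^ 3 * (L\<^sup>2 * B)) + 2 * real K * 1 + real K * real n"
      by (simp add: algebra_simps power2_eq_square power3_eq_cube)
    also have "\<dots> \<le> real n * L ^ 5 + 2016 * ((17 * L) ^ 3 * (L\<^sup>2 * B)) + 2 * (17 * L ^ 5) * real n
        + 17 * L ^ 5 * real n"
    proof (intro add_mono)
      show "real n \<le> real n * L ^ 5" using L5 by (simp add: mult_le_cancel_left1)
      show "2016 * ((real K) ^ 3 * (L\<^sup>2 * B)) \<le> 2016 * ((17 * L) ^ 3 * (L\<^sup>2 * B))"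
        using K K1 B0 by (intro mult_left_mono mult_right_mono power_mono) auto
      have K5: "real K \<le> 17 * L ^ 5" using K(2) L5 by linarith
      show "2 * real K * 1 \<le> 2 * (17 * L ^ 5) * real n"
        using K5 n_ge L5 L1 by (intro mult_mono) auto
      show "real K * real n \<le> 17 * L ^ 5 * real n" using K5 by (intro mult_right_mono) auto
    qed
    \<comment> \<open>\<open>52 = 1 + 34 + 17\<close> and
      \<open>9904608 = 2016 * 17^3\<close>.\<close>
    also have "\<dots> = (52 * real n + 9904608 * B) * L ^ 5"
      by (simp add: power_mult_distrib algebra_simps power_numeral_reduce)
    also have "\<dots> \<le> 10 ^ 7 * (real n + B) * L ^ 5"
      using B0 L1 by (intro mult_right_mono) (auto simp: algebra_simps)
    finally show "real (n + K * (T + n)) \<le>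
        10 ^ 7 * (real n + G\<^sup>2 * R\<^sup>2 / (\<alpha> * \<epsilon>\<^sup>2)) * log_factor n d R G M \<epsilon> ^ 5"
      by (simp only: L_def B_def)
  qed
qed

end

theorem theorem9:
  shows "\<exists>(A :: nat \<Rightarrow> nat \<Rightarrow> rvec set \<Rightarrow> real \<Rightarrow> real \<Rightarrow> real \<Rightarrow> real \<Rightarrow> real \<Rightarrow> query_alg) (C :: real) (k :: nat).
    \<forall>(n :: nat) (d :: nat) (X :: rvec set) (R :: real) (G :: real) (M :: real) (\<alpha> :: real) (\<epsilon> :: real)
     (f :: nat \<Rightarrow> rvec \<Rightarrow> real) (g :: nat \<Rightarrow> rvec \<Rightarrow> rvec).
      1 \<le> n \<longrightarrow>
      X \<noteq> {} \<longrightarrow> closedin (Euclidean_space d) X \<longrightarrow> convex_vset X \<longrightarrow>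
      (\<forall>x\<in>X. \<forall>y\<in>X. l2_dist d x y \<le> R) \<longrightarrow>
      (\<forall>i<n. convex_fun_on (Rspace d) (f i)) \<longrightarrow>
      (\<forall>i<n. l2_lipschitz d G (f i)) \<longrightarrow>
      (\<forall>i<n. \<forall>x\<in>X. f i x \<in> {0..M}) \<longrightarrow>
      (\<forall>i<n. \<forall>x\<in>X. is_subgradient d (f i) x (g i x)) \<longrightarrow>
      \<alpha> \<in> {1 / real n..1} \<longrightarrow>
      \<epsilon> \<in> {0<..<4 * M} \<longrightarrow>
      (let P = run_alg (first_order_oracle f g) (A n d X R G M \<alpha> \<epsilon>) in
        expected_eps_optimal (cvar_dual_feasible n \<alpha>) (dual_objective n X f) \<epsilon> (map_pmf snd P) \<and>
        (\<forall>(qs, y) \<in> set_pmf P.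
          set qs \<subseteq> {..<n} \<times> X \<and>
          real (length qs) \<le> soft_O_bound C k n d R G M \<epsilon> (real n + G\<^sup>2 * R\<^sup>2 / (\<alpha> * \<epsilon>\<^sup>2))))"
\<comment> \<open>The constant and the exponent come from the query count in
  \<open>dual_cvar_alg_correct\<close>.\<close>
proof (rule exI[of _ dual_cvar_alg], rule exI[of _ "10 ^ 7"], rule exI[of _ 5], intro allI impI)
  fix n d X R G M \<alpha> \<epsilon> f g
  assume asm: "1 \<le> n" "X \<noteq> {}" "closedin (Euclidean_space d) X" "convex_vset X"
    "\<forall>x\<in>X. \<forall>y\<in>X. l2_dist d x y \<le> R"
    "\<forall>i<n. convex_fun_on (Rspace d) (f i)" "\<forall>i<n. l2_lipschitz d G (f i)"
    "\<forall>i<n. \<forall>x\<in>X. f i x \<in> {0..M}" "\<forall>i<n. \<forall>x\<in>X. is_subgradient d (f i) x (g i x)"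
    "\<alpha> \<in> {1 / real n..1}" "\<epsilon> \<in> {0<..<4 * M}"
  interpret cvar_problem n d X R G M \<alpha> f g
    using asm by unfold_locales auto
  have "0 < \<epsilon>" "0 < M" using asm(11) by auto
  note correct = dual_cvar_alg_correct[OF this]
  obtain N where N: "query_bound oracle ({..<n} \<times> X) (capped_simplex n cap) N
      (dual_cvar_alg n d X R G M \<alpha> \<epsilon>)"
    "real N \<le> soft_O_bound (10 ^ 7) 5 n d R G M \<epsilon> (real n + G\<^sup>2 * R\<^sup>2 / (\<alpha> * \<epsilon>\<^sup>2))"
    using correct(2) unfolding soft_O_bound_def log_factor_def by blast
  show "let P = run_alg oracle (dual_cvar_alg n d X R G M \<alpha> \<epsilon>) in
      expected_eps_optimal (cvar_dual_feasible n \<alpha>) \<phi> \<epsilon> (map_pmf snd P) \<and>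
      (\<forall>(qs, y)\<in>set_pmf P. set qs \<subseteq> {..<n} \<times> X \<and>
        real (length qs) \<le> soft_O_bound (10 ^ 7) 5 n d R G M \<epsilon> (real n + G\<^sup>2 * R\<^sup>2 / (\<alpha> * \<epsilon>\<^sup>2)))"
    unfolding Let_def expected_eps_optimal_def cvar_dual_feasible_eq
  proof (intro conjI ballI)
    show "set_pmf (map_pmf snd (run_alg oracle (dual_cvar_alg n d X R G M \<alpha> \<epsilon>))) \<subseteq> capped_simplex n cap"
      using N(1) by (auto simp: query_bound_def)
    show "\<phi> y' \<le> measure_pmf.expectation
        (map_pmf snd (run_alg oracle (dual_cvar_alg n d X R G M \<alpha> \<epsilon>))) \<phi> + \<epsilon>"
      if "y' \<in> capped_simplex n cap" for y'
      using correct(1)[OF that] by (simp only: expected_output_def)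
    fix r assume r: "r \<in> set_pmf (run_alg oracle (dual_cvar_alg n d X R G M \<alpha> \<epsilon>))"
    obtain qs y where qy: "r = (qs, y)" by fastforce
    have "set qs \<subseteq> {..<n} \<times> X" "length qs \<le> N"
      using N(1) r unfolding query_bound_def qy by auto
    moreover from this(2) have "real (length qs)
        \<le> soft_O_bound (10 ^ 7) 5 n d R G M \<epsilon> (real n + G\<^sup>2 * R\<^sup>2 / (\<alpha> * \<epsilon>\<^sup>2))"
      using N(2) by linarith
    ultimately show "case r of (qs, y) \<Rightarrow> set qs \<subseteq> {..<n} \<times> X \<and>
        real (length qs) \<le> soft_O_bound (10 ^ 7) 5 n d R G M \<epsilon> (real n + G\<^sup>2 * R\<^sup>2 / (\<alpha> * \<epsilon>\<^sup>2))"
      by (simp add: qy)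
  qed
qed

end
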